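(* Let $n\ge 0$ and $p\ge 1$ be integers, and let $0<t<1$. Let $$f^{(2p)}_{n,n}=\frac{t^{p(n+p)}}{(p!)^2\pi^{2p}}\int_0^1dx_1\cdots\int_0^1dx_{2p}\prod_{i=1}^{2p}x_i^n\prod_{j=1}^p\left[\frac{(1-tx_{2j})(x_{2j}^{-1}-1)}{(1-tx_{2j-1})(x_{2j-1}^{-1}-1)}\right]^{1/2}$$ $$\times\prod_{j=1}^p\prod_{l=1}^p(1-tx_{2l-1}x_{2j})^{-2}\prod_{1\le j<l\le p}(x_{2j-1}-x_{2l-1})^2(x_{2j}-x_{2l})^2 ,$$ and let, for non-negative integers $i,j$, $$K(i,j)=\frac{(-\tfrac12)_{i+1}(\tfrac12)_{j+1}}{i!\,j!}\,t^{(i+j)/2+1}\frac{1}{i-j}\left[\frac{1}{j+1}\,{}_2F_1(\tfrac12,i+\tfrac32;i+1;t)\,{}_2F_1(\tfrac12,j+\tfrac12;j+2;t)\right.$$ $$\left.-\frac{1}{i+1}\,{}_2F_1(\tfrac12,j+\tfrac32;j+1;t)\,{}_2F_1(\tfrac12,i+\tfrac12;i+2;t)\right],$$ where $K(i,i)$ is understood as the limit $j\to i$. Then $$f^{(2p)}_{n,n}=(-1)^p\sum_{n_1>n_2>\cdots>n_p\ge n}\det\left[K(n_j,n_k)\right]_{1\le j,k\le p}.$$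
   Context: ${}_2F_1$ is the Gauss hypergeometric function and $(a)_m=\Gamma(a+m)/\Gamma(a)$ is the Pochhammer symbol. In the limit defining $K(i,i)$ the index $j$ is treated as a real variable, with factorials and Pochhammer symbols expressed through the Gamma function. The sum is over strictly decreasing $p$-tuples of integers $n_1>\cdots>n_p\ge n$. (In the paper $t=k^{-2}<1$, where $k=\sinh 2K_1\sinh 2K_2>1$ and $K_1,K_2$ are the Ising couplings.) *)

theory Defs
  imports "HOL-Analysis.Analysis" "Jordan_Normal_Form.Determinant"
begin

definition hyp2F1 :: "real \<Rightarrow> real \<Rightarrow> real \<Rightarrow> real \<Rightarrow> real" where
  "hyp2F1 a b c z = eval_fps (fps_hypergeo [a, b] [c] 1) z"

lemma hyp2F1_series:
  "hyp2F1 a b c z =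
     (\<Sum>m. pochhammer a m * pochhammer b m / (pochhammer c m * fact m) * z ^ m)"
  by (simp add: hyp2F1_def eval_fps_def)

text \<open>The library's \<open>pochhammer\<close> only takes a natural number as second argument.\<close>

definition poch :: "real \<Rightarrow> real \<Rightarrow> real" where
  "poch a x = Gamma (a + x) / Gamma a"

lemma poch_of_nat: "a \<notin> \<int>\<^sub>\<le>\<^sub>0 \<Longrightarrow> poch a (real m) = pochhammer a m"
  by (simp add: poch_def pochhammer_Gamma)

definition kernel_real :: "real \<Rightarrow> real \<Rightarrow> real \<Rightarrow> real" where
  "kernel_real t i j =
     poch (- 1 / 2) (i + 1) * poch (1 / 2) (j + 1) / (Gamma (i + 1) * Gamma (j + 1))
     * t powr ((i + j) / 2 + 1) * (1 / (i - j))
     * (1 / (j + 1) * hyp2F1 (1 / 2) (i + 3 / 2) (i + 1) t * hyp2F1 (1 / 2) (j + 1 / 2) (j + 2) t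
        - 1 / (i + 1) * hyp2F1 (1 / 2) (j + 3 / 2) (j + 1) t * hyp2F1 (1 / 2) (i + 1 / 2) (i + 2) t)"

definition kernel :: "real \<Rightarrow> nat \<Rightarrow> nat \<Rightarrow> real" where
  "kernel t i j =
     (if i = j then Lim (at (real i)) (\<lambda>y. kernel_real t (real i) y)
      else kernel_real t (real i) (real j))"

lemma kernel_off_diagonal:
  assumes "i \<noteq> j"
  shows "kernel t i j =
     pochhammer (- 1 / 2) (i + 1) * pochhammer (1 / 2) (j + 1) / (fact i * fact j)
     * t powr ((real i + real j) / 2 + 1) * (1 / (real i - real j))
     * (1 / (real j + 1) * hyp2F1 (1 / 2) (real i + 3 / 2) (real i + 1) t
          * hyp2F1 (1 / 2) (real j + 1 / 2) (real j + 2) t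
        - 1 / (real i + 1) * hyp2F1 (1 / 2) (real j + 3 / 2) (real j + 1) t
          * hyp2F1 (1 / 2) (real i + 1 / 2) (real i + 2) t)"
proof -
  have "(- 1 / 2 :: real) \<notin> \<int>\<^sub>\<le>\<^sub>0"
  proof
    assume "(- 1 / 2 :: real) \<in> \<int>\<^sub>\<le>\<^sub>0"
    then obtain k :: int where "(- 1 / 2 :: real) = of_int k"
      by (auto elim!: nonpos_Ints_cases)
    then have "of_int (2 * k) = (of_int (- 1) :: real)" by simp
    then have "2 * k = - 1" by (simp only: of_int_eq_iff)
    then show False by presburger
  qed
  from poch_of_nat[OF this, of "i + 1"]
  have 1: "poch (- 1 / 2) (real i + 1) = pochhammer (- 1 / 2) (i + 1)"
    by (simp add: add.commute)
  have "(1 / 2 :: real) \<notin> \<int>\<^sub>\<le>\<^sub>0"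
    by (auto dest: nonpos_Ints_nonpos)
  from poch_of_nat[OF this, of "j + 1"]
  have 2: "poch (1 / 2) (real j + 1) = pochhammer (1 / 2) (j + 1)"
    by (simp add: add.commute)
  have 3: "Gamma (real k + 1) = fact k" for k
    using Gamma_fact[of k, where 'a = real] by (simp add: add.commute)
  show ?thesis
    using assms by (simp only: kernel_def kernel_real_def 1 2 3 if_False)
qed

definition form_factor_integrand :: "real \<Rightarrow> nat \<Rightarrow> nat \<Rightarrow> (nat \<Rightarrow> real) \<Rightarrow> real" where
  "form_factor_integrand t n p x =
     (\<Prod>i=1..2*p. x i ^ n)
     * (\<Prod>j=1..p. sqrt (((1 - t * x (2*j)) * (inverse (x (2*j)) - 1))
                     / ((1 - t * x (2*j-1)) * (inverse (x (2*j-1)) - 1))))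
     * (\<Prod>j=1..p. \<Prod>l=1..p. (1 - t * x (2*l-1) * x (2*j)) powi (- 2))
     * (\<Prod>(j, l) \<in> {(j, l). 1 \<le> j \<and> j < l \<and> l \<le> p}.
          (x (2*j-1) - x (2*l-1))\<^sup>2 * (x (2*j) - x (2*l))\<^sup>2)"

text \<open>The integral is taken over the open cube, because the integrand is not defined
  on all of the boundary, which is a null set.\<close>

definition form_factor :: "real \<Rightarrow> nat \<Rightarrow> nat \<Rightarrow> real" where
  "form_factor t n p =
     t ^ (p * (n + p)) / ((fact p)\<^sup>2 * pi ^ (2 * p))
     * (LINT x : PiE {1..2*p} (\<lambda>_. {0<..<1}) | PiM {1..2*p} (\<lambda>_. lborel).
          form_factor_integrand t n p x)"

definition decreasing_tuples :: "nat \<Rightarrow> nat \<Rightarrow> nat list set" where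
  "decreasing_tuples n p =
     {ns. length ns = p \<and> sorted_wrt (>) ns \<and> (\<forall>m\<in>set ns. n \<le> m)}"

text \<open>\<open>HOL-Analysis\<close> also has a constant \<open>det\<close>, for matrices whose size is a type; here the
  size \<open>p\<close> is a number. The indices \<open>j\<close>, \<open>k\<close> run from \<open>0\<close> to \<open>p - 1\<close>.\<close>

definition kernel_det :: "real \<Rightarrow> nat list \<Rightarrow> real" where
  "kernel_det t ns =
     Determinant.det
       (Matrix.mat (length ns) (length ns) (\<lambda>(j, k). kernel t (ns ! j) (ns ! k)))"

end

theory Submission
  imports Defs
begin

text \<open>The argument rests on two moment sequences. With \<open>\<phi> x = sqrt ((1 - x) * (1 - t * x))\<close>, put
\<open>\<alpha> s = \<integral> x powr (s + 1/2) / \<phi> x\<close> and \<open>\<beta> s = \<integral> x powr (s - 1/2) * \<phi> x\<close> over the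
unit interval (\<open>invsqrt_moment\<close> and \<open>sqrt_moment\<close>), and let
\<open>M i j = (\<Sum>l. t ^ l * \<alpha> (j + l) * \<beta> (i + l))\<close> (\<open>moment_kernel\<close>). The proof expresses
both sides of the identity through \<open>M\<close>.

The kernel is a multiple of \<open>M\<close>: \<open>K i j = - t powr ((i + j) / 2 + 1) / pi\<^sup>2 * M i j\<close>
(\<open>kernel_eq\<close>). Euler's integral turns the four hypergeometric functions in \<open>K\<close> into combinations
of \<open>\<alpha>\<close>, and the bracket becomes a multiple of the Wronskian-like expression
\<open>W i j = \<alpha> (i - 1) * \<alpha> j - \<alpha> (j - 1) * \<alpha> i\<close>. Two linear relations between \<open>\<alpha>\<close> and \<open>\<beta>\<close>,
one pointwise and one from integration by parts, give
\<open>(j + 1/2) * W i j - t * (j + 3/2) * W (i + 1) (j + 1) = (j - i) * \<alpha> j * \<beta> i\<close>, and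
telescoping yields \<open>(j - i) * M i j = (j + 1/2) * W i j\<close>. All of this holds for real \<open>j\<close>, so
the diagonal values of \<open>K\<close> follow from the continuity of \<open>M\<close> in \<open>j\<close>.

For the integral, write \<open>y\<close> for the variables of odd index and \<open>z\<close> for those of even index. By
Cauchy's determinant formula (\<open>cauchy_det\<close>), the double products are, up to a power of \<open>t\<close>, the
square of the determinant of \<open>1 / (1 - t * y j * z k)\<close>; the factors \<open>x i ^ n\<close> are absorbed into
one of the two copies (\<open>integrand_as_determinants\<close>). Expanding both determinants over
permutations \<open>\<sigma>\<close> and \<open>\<tau>\<close>, and every entry as a geometric series, leaves nonnegative monomials,
which may be integrated term by term and factor into values of \<open>\<alpha>\<close> and \<open>\<beta>\<close>. Summing over one
family of exponents produces products of values of \<open>M\<close> that depend only on the composition of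
\<open>\<sigma>\<close> with the inverse of \<open>\<tau>\<close> (\<open>permutation_pair_integral\<close>). The signed sum over \<open>\<sigma>\<close> and \<open>\<tau>\<close> is
therefore \<open>p!\<close> times a sum, over tuples with entries at least \<open>n\<close>, of determinants of \<open>M\<close>
(\<open>cube_integral_eq_moment_det_sum\<close>). These determinants are symmetric in the tuple and vanish
when an entry is repeated, so restricting to strictly decreasing tuples yields a second factor
\<open>p!\<close> (\<open>infsum_symmetric_tuples\<close>), and the two cancel the \<open>(p!)\<^sup>2\<close> in the definition of
the form factor.\<close>

section \<open>Series of nonnegative functions\<close>

lemma has_bochner_integral_has_sum_nonneg:
  fixes f :: "'i \<Rightarrow> 'a \<Rightarrow> real"
  assumes "countable I"
    and int: "\<And>i. i \<in> I \<Longrightarrow> integrable M (f i)"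
    and nonneg: "\<And>i x. i \<in> I \<Longrightarrow> x \<in> space M \<Longrightarrow> 0 \<le> f i x"
    and lim: "\<And>x. x \<in> space M \<Longrightarrow> ((\<lambda>i. f i x) has_sum g x) I"
    and sum: "((\<lambda>i. integral\<^sup>L M (f i)) has_sum S) I"
  shows "has_bochner_integral M g S"
proof -
  have count: "(\<integral>\<^sup>+i. ennreal (h i) \<partial>count_space I) = ennreal s"
    if "(h has_sum s) I" "\<And>i. i \<in> I \<Longrightarrow> 0 \<le> h i" for h :: "'i \<Rightarrow> real" and s
  proof -
    have "h summable_on I" using that(1) by (rule has_sum_imp_summable)
    hence "(\<lambda>i. norm (h i)) summable_on I"
      by (rule summable_on_cong[THEN iffD1, rotated]) (use that(2) in auto)
    hence "Infinite_Set_Sum.abs_summable_on h I"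
      by (rule abs_summable_equivalent[THEN iffD1])
    thus ?thesis
      using that by (simp add: nn_integral_conv_infsetsum infsetsum_infsum infsumI)
  qed
  have S: "0 \<le> S"
    by (rule has_sum_nonneg[OF sum]) (auto intro: integral_nonneg_AE AE_I2 nonneg)
  have g: "0 \<le> g x" if "x \<in> space M" for x
    by (rule has_sum_nonneg[OF lim[OF that]]) (use nonneg that in auto)
  have meas[measurable]: "(\<lambda>x. ennreal (f i x)) \<in> borel_measurable M" if "i \<in> I" for i
    using int[OF that] by auto
  have eq: "ennreal (g x) = (\<integral>\<^sup>+i. ennreal (f i x) \<partial>count_space I)" if "x \<in> space M" for x
    using count[OF lim[OF that]] nonneg that by simp
  have "(\<integral>\<^sup>+x. ennreal (g x) \<partial>M) = (\<integral>\<^sup>+x. \<integral>\<^sup>+i. ennreal (f i x) \<partial>count_space I \<partial>M)"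
    by (intro nn_integral_cong eq)
  also have "\<dots> = (\<integral>\<^sup>+i. \<integral>\<^sup>+x. ennreal (f i x) \<partial>M \<partial>count_space I)"
    by (intro nn_integral_count_space_nn_integral assms meas)
  also have "\<dots> = (\<integral>\<^sup>+i. ennreal (integral\<^sup>L M (f i)) \<partial>count_space I)"
    by (intro nn_integral_cong nn_integral_eq_integral int AE_I2 nonneg) auto
  also have "\<dots> = ennreal S"
    by (intro count sum integral_nonneg_AE AE_I2 nonneg)
  finally have nn: "(\<integral>\<^sup>+x. ennreal (g x) \<partial>M) = ennreal S" .
  have "g \<in> borel_measurable M"
  proof (cases "finite I")
    case True
    have "g x = (\<Sum>i\<in>I. f i x)" if "x \<in> space M" for x
      using lim[OF that] True by (simp add: has_sum_finite_iff)
    moreover have "(\<lambda>x. \<Sum>i\<in>I. f i x) \<in> borel_measurable M"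
      using int by (intro borel_measurable_sum) auto
    ultimately show ?thesis by (subst measurable_cong) auto
  next
    case False
    note bij = bij_betw_from_nat_into[OF \<open>countable I\<close> False]
    have "(\<lambda>k. \<Sum>j<k. f (from_nat_into I j) x) \<longlonglongrightarrow> g x" if "x \<in> space M" for x
    proof -
      have "((\<lambda>k. f (from_nat_into I k) x) has_sum g x) UNIV"
        using lim[OF that] has_sum_reindex_bij_betw[OF bij, of "\<lambda>i. f i x"] by simp
      from has_sum_imp_sums[OF this] show ?thesis by (simp add: sums_def)
    qed
    moreover have "(\<lambda>x. \<Sum>j<k. f (from_nat_into I j) x) \<in> borel_measurable M" for k
      using int bij_betwE[OF bij] by (intro borel_measurable_sum) auto
    ultimately show ?thesis by (rule borel_measurable_LIMSEQ_real)
  qed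
  thus ?thesis
    by (rule has_bochner_integral_nn_integral) (use g S nn in auto)
qed

lemma has_sum_linear_combination:
  fixes f :: "'i \<Rightarrow> 'a \<Rightarrow> real"
  assumes "finite I" "\<And>i. i \<in> I \<Longrightarrow> (f i has_sum s i) A"
  shows "((\<lambda>x. \<Sum>i\<in>I. c i * f i x) has_sum (\<Sum>i\<in>I. c i * s i)) A"
  using assms
  by (induction I rule: finite_induct) (auto intro!: has_sum_add has_sum_cmult_right)

lemma has_sum_prod_PiE_nonneg:
  fixes f :: "'a \<Rightarrow> 'b \<Rightarrow> real"
  assumes "finite A" and "\<And>x. x \<in> A \<Longrightarrow> (f x has_sum s x) (B x)"
    and "\<And>x y. x \<in> A \<Longrightarrow> y \<in> B x \<Longrightarrow> 0 \<le> f x y"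
  shows "((\<lambda>g. \<Prod>x\<in>A. f x (g x)) has_sum (\<Prod>x\<in>A. s x)) (PiE A B)"
  using assms
proof (induction A)
  case empty
  show ?case by (simp add: has_sum_finite_iff)
next
  case (insert a A)
  have bij: "bij_betw (\<lambda>(y, g). g(a := y)) (B a \<times> PiE A B) (PiE (insert a A) B)"
    using insert.hyps inj_combinator[of a A B] by (auto simp: bij_betw_def PiE_insert_eq)
  have "((\<lambda>(y, g). f a y * (\<Prod>x\<in>A. f x (g x))) has_sum (s a * (\<Prod>x\<in>A. s x))) (B a \<times> PiE A B)"
  proof (rule has_sum_SigmaI)
    have IH: "((\<lambda>g. \<Prod>x\<in>A. f x (g x)) has_sum (\<Prod>x\<in>A. s x)) (PiE A B)"
      by (rule insert.IH) (use insert.prems in auto)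
    show row: "((\<lambda>g. case (y, g) of (y, g) \<Rightarrow> f a y * (\<Prod>x\<in>A. f x (g x))) has_sum
            (f a y * (\<Prod>x\<in>A. s x))) (PiE A B)" for y
      using has_sum_cmult_right[OF IH, of "f a y"] by simp
    show col: "((\<lambda>y. f a y * (\<Prod>x\<in>A. s x)) has_sum (s a * (\<Prod>x\<in>A. s x))) (B a)"
      by (intro has_sum_cmult_left insert.prems) auto
    show "(\<lambda>(y, g). f a y * (\<Prod>x\<in>A. f x (g x))) summable_on (B a \<times> PiE A B)"
    proof (rule summable_on_SigmaI[OF row])
      show "(\<lambda>y. f a y * (\<Prod>x\<in>A. s x)) summable_on B a"
        using col by (rule has_sum_imp_summable)
    qed (use insert.prems in \<open>auto intro!: mult_nonneg_nonneg prod_nonneg\<close>)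
  qed
  also have "(\<lambda>(y, g). f a y * (\<Prod>x\<in>A. f x (g x))) =
             (\<lambda>z. \<Prod>x\<in>insert a A. f x ((case z of (y, g) \<Rightarrow> g(a := y)) x))"
    using insert.hyps by (auto simp: fun_eq_iff intro!: prod.cong)
  finally show ?case
    using insert.hyps by (subst (asm) has_sum_reindex_bij_betw[OF bij]) simp
qed

lemma geometric_has_sum:
  fixes q :: real
  assumes "0 \<le> q" "q < 1"
  shows "((\<lambda>m. q ^ m) has_sum (q ^ n / (1 - q))) {n..}"
proof -
  have "(\<lambda>m. q ^ n * q ^ m) sums (q ^ n * (1 / (1 - q)))"
    using assms by (intro sums_mult geometric_sums) auto
  hence "((\<lambda>m. q ^ n * q ^ m) has_sum (q ^ n * (1 / (1 - q)))) UNIV"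
    by (rule sums_nonneg_imp_has_sum) (use assms in auto)
  moreover have "bij_betw (\<lambda>m. n + m) UNIV {n..}"
    by (rule bij_betwI[of _ _ _ "\<lambda>m. m - n"]) auto
  ultimately show ?thesis
    using has_sum_reindex_bij_betw[of "\<lambda>m. n + m" UNIV "{n..}" "\<lambda>m. q ^ m"] by (simp add: power_add)
qed

section \<open>Moments of the weight function\<close>

text \<open>Euler's integral for \<open>a = 1/2\<close>, with \<open>c = b + d\<close>. The prefactor \<open>\<Gamma>(b) \<Gamma>(c - b) / \<Gamma>(c)\<close> and the
quotient of Pochhammer symbols are kept together as \<open>Beta (b + m) d\<close>, which makes all terms
visibly nonnegative.\<close>

lemma euler_integral:
  fixes b d t :: real
  assumes b: "0 < b" and d: "0 < d" and t: "0 \<le> t" "t < 1"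
  defines "f \<equiv> (\<lambda>x. x powr (b - 1) * (1 - x) powr (d - 1) / sqrt (1 - t * x))"
  shows "set_integrable lborel {0<..<1} f"
    and "(\<lambda>m. pochhammer (1 / 2) m / fact m * Beta (b + real m) d * t ^ m) sums
           (LINT x:{0<..<1}|lborel. f x)"
proof -
  define c :: "nat \<Rightarrow> real" where "c m = pochhammer (1 / 2) m / fact m" for m
  have c0: "0 \<le> c m" for m
    by (simp add: c_def pochhammer_nonneg)
  have binom: "(\<lambda>m. c m * z ^ m) sums (1 / sqrt (1 - z))" if "0 \<le> z" "z < 1" for z :: real
  proof -
    have "(\<lambda>m. ((- (1 / 2)) gchoose m) * (- z) ^ m) sums (1 + - z) powr (- (1 / 2))"
      by (rule gen_binomial_real) (use that in auto)
    moreover have "((- (1 / 2)) gchoose m) * (- z) ^ m = c m * z ^ m" for m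
    proof -
      have "(- z) ^ m = (- 1) ^ m * z ^ m" by (rule power_minus)
      thus ?thesis by (simp add: gbinomial_pochhammer c_def minus_one_power_iff)
    qed
    moreover have "(1 + - z) powr (- (1 / 2)) = 1 / sqrt (1 - z)"
      using that by (simp add: powr_minus_divide powr_half_sqrt)
    ultimately show ?thesis by simp
  qed
  define h :: "nat \<Rightarrow> real \<Rightarrow> real" where
    "h m x = indicator {0<..<1} x * (c m * t ^ m * (x powr (b + real m - 1) * (1 - x) powr (d - 1)))"
    for m x
  have beta: "has_bochner_integral lborel (h m) (c m * Beta (b + real m) d * t ^ m)" for m
  proof -
    have b': "0 < b + real m" using b by simp
    have "set_integrable lborel {0..1} (\<lambda>x. x powr (b + real m - 1) * (1 - x) powr (d - 1))"
      by (rule integrable_Beta[OF b' d])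
    hence int: "set_integrable lborel {0<..<1}
          (\<lambda>x. x powr (b + real m - 1) * (1 - x) powr (d - 1))"
      by (rule set_integrable_subset) auto
    from set_borel_integral_eq_integral[OF int]
      has_integral_Beta_real[OF b' d, unfolded has_integral_Icc_iff_Ioo]
    have "(LINT x:{0<..<1}|lborel. x powr (b + real m - 1) * (1 - x) powr (d - 1)) =
          Beta (b + real m) d"
      by (simp add: has_integral_iff)
    with int show ?thesis
      unfolding h_def set_integrable_def set_lebesgue_integral_def
      by (simp add: has_bochner_integral_iff mult_ac)
  qed
  have sumb: "summable (\<lambda>m. c m * Beta (b + real m) d * t ^ m)"
  proof (rule summable_comparison_test')
    show "summable (\<lambda>m. Beta b d * (c m * t ^ m))"
      using binom[OF t] by (intro summable_mult) (rule sums_summable)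
    fix m :: nat
    have "Beta (b + real m) d \<le> Beta b d"
      by (rule Beta_real_mono) (use b d in auto)
    moreover have "0 \<le> Beta (b + real m) d"
      using b d by (simp add: Beta_def Gamma_real_nonneg)
    ultimately have "(c m * t ^ m) * Beta (b + real m) d \<le> (c m * t ^ m) * Beta b d"
      and "0 \<le> (c m * t ^ m) * Beta (b + real m) d"
      using c0[of m] t by (auto intro!: mult_left_mono)
    thus "norm (c m * Beta (b + real m) d * t ^ m) \<le> Beta b d * (c m * t ^ m)"
      by (simp add: mult_ac)
  qed
  have bpos: "0 \<le> Beta (b + real m) d" for m
      using b d by (simp add: Beta_def Gamma_real_nonneg)
  have "has_bochner_integral lborel (\<lambda>x. indicator {0<..<1} x *\<^sub>R f x)
          (\<Sum>m. c m * Beta (b + real m) d * t ^ m)"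
  proof (rule has_bochner_integral_has_sum_nonneg[of "UNIV :: nat set" _ h])
    fix x :: real
    show "((\<lambda>m. h m x) has_sum (indicator {0<..<1} x *\<^sub>R f x)) UNIV"
    proof (rule sums_nonneg_imp_has_sum)
      show "0 \<le> h m x" for m
        using c0[of m] t by (auto simp: h_def indicator_def)
      show "(\<lambda>m. h m x) sums (indicator {0<..<1} x *\<^sub>R f x)"
      proof (cases "x \<in> {0<..<1}")
        case True
        hence tx: "0 \<le> t * x" "t * x < 1" using t by (auto, smt (verit) mult_left_le)
        have "(\<lambda>m. (x powr (b - 1) * (1 - x) powr (d - 1)) * (c m * (t * x) ^ m)) sums
                ((x powr (b - 1) * (1 - x) powr (d - 1)) * (1 / sqrt (1 - t * x)))"
          by (intro sums_mult binom tx)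
        moreover have "(x powr (b - 1) * (1 - x) powr (d - 1)) * (c m * (t * x) ^ m) = h m x" for m
        proof -
          have "x powr (b + real m - 1) = x powr (b - 1) * x ^ m"
            using True by (simp add: powr_add[symmetric] powr_realpow[symmetric] algebra_simps)
          with True show ?thesis by (simp add: h_def power_mult_distrib)
        qed
        ultimately show ?thesis using True by (simp add: f_def)
      qed (simp add: h_def)
    qed
  next
    have "(\<lambda>m. integral\<^sup>L lborel (h m)) = (\<lambda>m. c m * Beta (b + real m) d * t ^ m)"
      using beta by (auto simp: has_bochner_integral_iff)
    moreover have "((\<lambda>m. c m * Beta (b + real m) d * t ^ m) has_sum
                     (\<Sum>m. c m * Beta (b + real m) d * t ^ m)) UNIV"
      by (rule sums_nonneg_imp_has_sum) (use sumb c0 bpos t in \<open>auto simp: summable_sums\<close>)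
    ultimately show "((\<lambda>m. integral\<^sup>L lborel (h m)) has_sum
                     (\<Sum>m. c m * Beta (b + real m) d * t ^ m)) UNIV" by simp
  qed (use beta c0 t in \<open>auto simp: has_bochner_integral_iff h_def\<close>)
  with sumb show "set_integrable lborel {0<..<1} f"
    and "(\<lambda>m. pochhammer (1 / 2) m / fact m * Beta (b + real m) d * t ^ m) sums
           (LINT x:{0<..<1}|lborel. f x)"
    by (auto simp: has_bochner_integral_iff set_integrable_def set_lebesgue_integral_def c_def
        summable_sums)
qed

text \<open>The moments of \<open>sqrt x / sqrt ((1 - x) * (1 - t * x))\<close> and of
\<open>sqrt ((1 - x) * (1 - t * x)) / sqrt x\<close>. The exponent \<open>s\<close> is real, because the diagonal
values of the kernel are limits in a real index. The integrals converge for \<open>s > - 3 / 2\<close>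
and \<open>s > - 1 / 2\<close> respectively; the first is also used at \<open>s - 1\<close> with \<open>s > - 1 / 2\<close>.\<close>

definition invsqrt_moment :: "real \<Rightarrow> real \<Rightarrow> real" where
  "invsqrt_moment t s =
     (LINT x:{0<..<1}|lborel. x powr (s + 1 / 2) / sqrt ((1 - x) * (1 - t * x)))"

definition sqrt_moment :: "real \<Rightarrow> real \<Rightarrow> real" where
  "sqrt_moment t s =
     (LINT x:{0<..<1}|lborel. x powr (s - 1 / 2) * sqrt ((1 - x) * (1 - t * x)))"

lemma invsqrt_weight:
  assumes "x \<in> {0<..<1::real}"
  shows "x powr (s + 1 / 2) / sqrt ((1 - x) * (1 - t * x)) =
         x powr (s + 3 / 2 - 1) * (1 - x) powr (1 / 2 - 1) / sqrt (1 - t * x)"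
proof -
  have "(1 - x) powr (1 / 2 - 1) = 1 / sqrt (1 - x)"
    using assms by (simp add: powr_minus_divide powr_half_sqrt)
  thus ?thesis by (simp add: real_sqrt_mult add.commute)
qed

lemma invsqrt_moment_integrable:
  assumes "0 \<le> t" "t < 1" "s > - 3 / 2"
  shows "set_integrable lborel {0<..<1} (\<lambda>x. x powr (s + 1 / 2) / sqrt ((1 - x) * (1 - t * x)))"
proof -
  have "set_integrable lborel {0<..<1} (\<lambda>x. x powr (s + 3 / 2 - 1) * (1 - x) powr (1 / 2 - 1) / sqrt (1 - t * x))"
    by (rule euler_integral) (use assms in auto)
  thus ?thesis
    by (subst set_integrable_cong[OF refl refl invsqrt_weight]) auto
qed

lemma invsqrt_moment_sums:
  assumes "0 \<le> t" "t < 1" "s > - 3 / 2"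
  shows "(\<lambda>m. pochhammer (1 / 2) m / fact m * Beta (s + 3 / 2 + real m) (1 / 2) * t ^ m)
           sums invsqrt_moment t s"
proof -
  have "invsqrt_moment t s = (LINT x:{0<..<1}|lborel.
          x powr (s + 3 / 2 - 1) * (1 - x) powr (1 / 2 - 1) / sqrt (1 - t * x))"
    unfolding invsqrt_moment_def
    by (intro set_lebesgue_integral_cong) (use invsqrt_weight in auto)
  thus ?thesis
    using euler_integral(2)[of "s + 3 / 2" "1 / 2" t] assms by simp
qed

lemma
  fixes a b c :: real and f g h :: "'a \<Rightarrow> real"
  assumes "set_integrable M A f" "set_integrable M A g" "set_integrable M A h"
  shows set_integrable_lincomb3: "set_integrable M A (\<lambda>x. a * f x + b * g x + c * h x)"
    and set_integral_lincomb3: "(LINT x:A|M. a * f x + b * g x + c * h x) =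
          a * (LINT x:A|M. f x) + b * (LINT x:A|M. g x) + c * (LINT x:A|M. h x)"
proof -
  have i: "set_integrable M A (\<lambda>x. a * f x)" "set_integrable M A (\<lambda>x. b * g x)"
      "set_integrable M A (\<lambda>x. c * h x)"
    using assms by (auto intro: set_integrable_mult_right)
  note ab = set_integral_add[OF i(1,2)]
  note abc = set_integral_add[OF ab(1) i(3)]
  show "set_integrable M A (\<lambda>x. a * f x + b * g x + c * h x)"
    by (rule abc(1))
  show "(LINT x:A|M. a * f x + b * g x + c * h x) =
          a * (LINT x:A|M. f x) + b * (LINT x:A|M. g x) + c * (LINT x:A|M. h x)"
    by (simp only: abc(2) ab(2) set_integral_mult_right)
qed

lemma powr_plus_one:
  fixes x a :: real
  assumes "0 < x"
  shows "x powr (a + 1) = x powr a * x"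
  using assms by (simp add: powr_add)

text \<open>Multiplying and dividing by the square root turns the second weight into a quadratic polynomial
times the first, since \<open>(1 - x) * (1 - t * x) = 1 - (1 + t) * x + t * x\<^sup>2\<close>.\<close>

lemma sqrt_weight:
  assumes "x \<in> {0<..<1::real}" "0 \<le> t" "t < 1"
  shows "x powr (s - 1 / 2) * sqrt ((1 - x) * (1 - t * x)) =
          1 * (x powr (s - 1 + 1 / 2) / sqrt ((1 - x) * (1 - t * x)))
          + (- (1 + t)) * (x powr (s + 1 / 2) / sqrt ((1 - x) * (1 - t * x)))
          + t * (x powr (s + 1 + 1 / 2) / sqrt ((1 - x) * (1 - t * x)))"
proof -
  have tx: "t * x < 1" using assms by (smt (verit) greaterThanLessThan_iff mult_left_le)
  define q where "q = sqrt ((1 - x) * (1 - t * x))"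
  have q: "q > 0" "q * q = (1 - x) * (1 - t * x)"
    using tx assms(1) by (auto simp: q_def simp flip: power2_eq_square)
  define P where "P = x powr (s - 1 / 2)"
  have x: "0 < x" using assms by simp
  have p1: "x powr (s + 1 / 2) = P * x"
    using powr_plus_one[OF x, of "s - 1 / 2"] by (simp add: P_def add.commute)
  have p2: "x powr (s + 1 + 1 / 2) = P * x * x"
    using powr_plus_one[OF x, of "s + 1 / 2"] p1 by (simp add: add_ac)
  have p0: "x powr (s - 1 + 1 / 2) = P"
    unfolding P_def by (rule arg_cong[of _ _ "\<lambda>a. x powr a"]) simp
  have "P * q = P * (q * q) / q"
    using q(1) by simp
  also have "\<dots> = P * (1 - (1 + t) * x + t * x * x) / q"
    by (simp add: q(2) algebra_simps)
  also have "\<dots> = 1 * (P / q) + (- (1 + t)) * (P * x / q) + t * (P * x * x / q)"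
    using q by (simp add: field_simps)
  finally show ?thesis unfolding q_def[symmetric] p0 p1 p2 P_def[symmetric] .
qed

lemma
  assumes t: "0 \<le> t" "t < 1" and s: "s > - 1 / 2"
  shows sqrt_moment_integrable:
      "set_integrable lborel {0<..<1} (\<lambda>x. x powr (s - 1 / 2) * sqrt ((1 - x) * (1 - t * x)))"
    and sqrt_moment_eq:
      "sqrt_moment t s = invsqrt_moment t (s - 1) - (1 + t) * invsqrt_moment t s
         + t * invsqrt_moment t (s + 1)"
proof -
  have i: "set_integrable lborel {0<..<1} (\<lambda>x. x powr (s - 1 + 1 / 2) / sqrt ((1 - x) * (1 - t * x)))"
      "set_integrable lborel {0<..<1} (\<lambda>x. x powr (s + 1 / 2) / sqrt ((1 - x) * (1 - t * x)))"
      "set_integrable lborel {0<..<1} (\<lambda>x. x powr (s + 1 + 1 / 2) / sqrt ((1 - x) * (1 - t * x)))"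
    by (rule invsqrt_moment_integrable; use t s in simp)+
  show "set_integrable lborel {0<..<1} (\<lambda>x. x powr (s - 1 / 2) * sqrt ((1 - x) * (1 - t * x)))"
    using set_integrable_lincomb3[OF i, of 1 "- (1 + t)" t]
    by (rule set_integrable_cong[THEN iffD2, OF refl refl sqrt_weight[OF _ t], rotated])
  have "sqrt_moment t s = (LINT x:{0<..<1}|lborel.
          1 * (x powr (s - 1 + 1 / 2) / sqrt ((1 - x) * (1 - t * x)))
          + (- (1 + t)) * (x powr (s + 1 / 2) / sqrt ((1 - x) * (1 - t * x)))
          + t * (x powr (s + 1 + 1 / 2) / sqrt ((1 - x) * (1 - t * x))))"
    unfolding sqrt_moment_def
    by (intro set_lebesgue_integral_cong) (use sqrt_weight[OF _ t] in auto)
  also have "\<dots> = 1 * invsqrt_moment t (s - 1) + (- (1 + t)) * invsqrt_moment t s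
         + t * invsqrt_moment t (s + 1)"
    unfolding invsqrt_moment_def by (rule set_integral_lincomb3[OF i])
  finally show "sqrt_moment t s = invsqrt_moment t (s - 1) - (1 + t) * invsqrt_moment t s
         + t * invsqrt_moment t (s + 1)" by (simp add: algebra_simps)
qed

text \<open>A second relation between the two kinds of moments: the derivative of
\<open>x powr (s + 1 / 2) * sqrt ((1 - x) * (1 - t * x))\<close> has integral \<open>0\<close>, as the function vanishes at
both ends. Together with \<open>sqrt_moment_eq\<close> it yields a three-term recurrence.\<close>

lemma sqrt_moment_by_parts:
  assumes t: "0 \<le> t" "t < 1" and s: "s > - 1 / 2"
  shows "(2 * s + 1) * sqrt_moment t s =
          (1 + t) * invsqrt_moment t s - 2 * t * invsqrt_moment t (s + 1)"
proof -
  define F where "F x = x powr (s + 1 / 2) * sqrt ((1 - x) * (1 - t * x))" for x :: real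
  define g0 where "g0 x = x powr (s - 1 / 2) * sqrt ((1 - x) * (1 - t * x))" for x :: real
  define g1 where "g1 x = x powr (s + 1 / 2) / sqrt ((1 - x) * (1 - t * x))" for x :: real
  define g2 where "g2 x = x powr (s + 1 + 1 / 2) / sqrt ((1 - x) * (1 - t * x))" for x :: real
  define f where "f x = (s + 1 / 2) * g0 x + (- (1 + t) / 2) * g1 x + t * g2 x" for x
  have der: "(F has_vector_derivative f x) (at x)" if x: "x \<in> {0<..<1}" for x
  proof -
    define q where "q = sqrt ((1 - x) * (1 - t * x))"
    have tx: "t * x < 1" using x t by (smt (verit) greaterThanLessThan_iff mult_left_le)
    have pos: "(1 - x) * (1 - t * x) > 0" using x tx by simp
    hence q: "q > 0" by (simp add: q_def)
    have x0: "0 < x" using x by simp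
    have d1: "((\<lambda>x. x powr (s + 1 / 2)) has_real_derivative ((s + 1 / 2) * x powr (s - 1 / 2))) (at x)"
      using has_real_derivative_powr[OF x0, of "s + 1 / 2"] by simp
    have d2: "((\<lambda>x. (1 - x) * (1 - t * x)) has_real_derivative (- (1 - t * x) - t * (1 - x))) (at x)"
      by (auto intro!: derivative_eq_intros)
    have d3: "((\<lambda>x. sqrt ((1 - x) * (1 - t * x))) has_real_derivative
             ((inverse q / 2) * (- (1 - t * x) - t * (1 - x)))) (at x)"
      unfolding q_def by (rule DERIV_chain2[OF DERIV_real_sqrt[OF pos] d2])
    have "(F has_real_derivative ((s + 1 / 2) * x powr (s - 1 / 2) * q
            + (inverse q / 2) * (- (1 - t * x) - t * (1 - x)) * x powr (s + 1 / 2))) (at x)"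
      unfolding F_def q_def by (rule DERIV_mult[OF d1 d3[unfolded q_def]])
    also have "(s + 1 / 2) * x powr (s - 1 / 2) * q
            + (inverse q / 2) * (- (1 - t * x) - t * (1 - x)) * x powr (s + 1 / 2) = f x"
    proof -
      define P where "P = x powr (s + 1 / 2)"
      have p: "x powr (s + 1 + 1 / 2) = P * x"
        using powr_plus_one[OF x0, of "s + 1 / 2"] by (simp add: P_def add_ac)
      show ?thesis
        unfolding f_def g0_def g1_def g2_def q_def[symmetric] p P_def[symmetric]
        using q by (simp add: field_simps)
    qed
    finally show ?thesis by (simp add: has_real_derivative_iff_has_vector_derivative)
  qed
  have cont: "continuous_on {0..1} F"
    unfolding F_def using s by (intro continuous_intros continuous_on_powr') auto
  have F: "F 0 = 0" "F 1 = 0" using s by (simp_all add: F_def)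
  have hk: "(f has_integral 0) {0<..<1}"
    using fundamental_theorem_of_calculus_interior[OF _ cont der] F
    by (simp add: has_integral_Icc_iff_Ioo)
  have i0: "set_integrable lborel {0<..<1} g0"
    unfolding g0_def by (rule sqrt_moment_integrable) (use t s in auto)
  have i1: "set_integrable lborel {0<..<1} g1"
    unfolding g1_def by (rule invsqrt_moment_integrable) (use t s in auto)
  have i2: "set_integrable lborel {0<..<1} g2"
    unfolding g2_def by (rule invsqrt_moment_integrable) (use t s in auto)
  have i: "set_integrable lborel {0<..<1} f"
    unfolding f_def by (rule set_integrable_lincomb3[OF i0 i1 i2])
  from set_borel_integral_eq_integral[OF i] hk
  have "0 = (LINT x:{0<..<1}|lborel. f x)" by (simp add: has_integral_iff)
  also have "\<dots> = (s + 1 / 2) * sqrt_moment t s + (- (1 + t) / 2) * invsqrt_moment t s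
                    + t * invsqrt_moment t (s + 1)"
    unfolding f_def set_integral_lincomb3[OF i0 i1 i2]
    unfolding g0_def g1_def g2_def sqrt_moment_def invsqrt_moment_def ..
  finally show ?thesis by (simp add: field_simps)
qed

lemma invsqrt_moment_nonneg: "0 \<le> t \<Longrightarrow> t < 1 \<Longrightarrow> 0 \<le> invsqrt_moment t s"
  unfolding invsqrt_moment_def set_lebesgue_integral_def
  by (intro Bochner_Integration.integral_nonneg)
     (auto simp: indicator_def intro!: divide_nonneg_nonneg mult_nonneg_nonneg,
      smt (verit) mult_left_le)

lemma sqrt_moment_nonneg: "0 \<le> t \<Longrightarrow> t < 1 \<Longrightarrow> 0 \<le> sqrt_moment t s"
  unfolding sqrt_moment_def set_lebesgue_integral_def
  by (intro Bochner_Integration.integral_nonneg)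
     (auto simp: indicator_def intro!: mult_nonneg_nonneg, smt (verit) mult_left_le)

lemma weight_pos:
  fixes x t :: real
  assumes "x \<in> {0<..<1}" "t < 1" "0 \<le> t"
  shows "0 < (1 - x) * (1 - t * x)"
  using assms by (smt (verit) greaterThanLessThan_iff mult_left_le mult_pos_pos)

lemma invsqrt_moment_antimono:
  assumes "0 \<le> t" "t < 1" "s > - 3 / 2" "s \<le> s'"
  shows "invsqrt_moment t s' \<le> invsqrt_moment t s"
  unfolding invsqrt_moment_def
proof (rule set_integral_mono)
  fix x :: real assume x: "x \<in> {0<..<1}"
  have "x powr (s' + 1 / 2) \<le> x powr (s + 1 / 2)"
    using x assms by (intro powr_mono') auto
  thus "x powr (s' + 1 / 2) / sqrt ((1 - x) * (1 - t * x))
         \<le> x powr (s + 1 / 2) / sqrt ((1 - x) * (1 - t * x))"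
    using weight_pos[OF x, of t] assms by (intro divide_right_mono) auto
qed (use assms in \<open>auto intro!: invsqrt_moment_integrable\<close>)

lemma sqrt_moment_antimono:
  assumes "0 \<le> t" "t < 1" "s > - 1 / 2" "s \<le> s'"
  shows "sqrt_moment t s' \<le> sqrt_moment t s"
  unfolding sqrt_moment_def
proof (rule set_integral_mono)
  fix x :: real assume x: "x \<in> {0<..<1}"
  have "x powr (s' - 1 / 2) \<le> x powr (s - 1 / 2)"
    using x assms by (intro powr_mono') auto
  thus "x powr (s' - 1 / 2) * sqrt ((1 - x) * (1 - t * x))
         \<le> x powr (s - 1 / 2) * sqrt ((1 - x) * (1 - t * x))"
    using weight_pos[OF x, of t] assms by (intro mult_right_mono) auto
qed (use assms in \<open>auto intro!: sqrt_moment_integrable\<close>)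

lemma continuous_on_invsqrt_moment:
  assumes "0 \<le> t" "t < 1" "s > - 3 / 2"
  shows "continuous_on {s..} (invsqrt_moment t)"
  unfolding continuous_on_sequentially
proof (intro allI ballI impI)
  fix u :: "nat \<Rightarrow> real" and c :: real
  assume c: "c \<in> {s..}" and u: "(\<forall>n. u n \<in> {s..}) \<and> u \<longlonglongrightarrow> c"
  have int: "set_integrable lborel {0<..<1} (\<lambda>x. x powr (r + 1 / 2) / sqrt ((1 - x) * (1 - t * x)))"
    if "s \<le> r" for r
    by (rule invsqrt_moment_integrable) (use assms that in auto)
  show "(invsqrt_moment t \<circ> u) \<longlonglongrightarrow> invsqrt_moment t c"
    unfolding o_def invsqrt_moment_def set_lebesgue_integral_def
  proof (rule integral_dominated_convergence)
    show "integrable lborel (\<lambda>x. indicator {0<..<1} x *\<^sub>R (x powr (s + 1 / 2) / sqrt ((1 - x) * (1 - t * x))))"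
      using int[of s] by (simp add: set_integrable_def)
    show "(\<lambda>x. indicator {0<..<1} x *\<^sub>R (x powr (c + 1 / 2) / sqrt ((1 - x) * (1 - t * x))))
            \<in> borel_measurable lborel"
      using int[of c] c by (auto simp: set_integrable_def)
    show "(\<lambda>x. indicator {0<..<1} x *\<^sub>R (x powr (u n + 1 / 2) / sqrt ((1 - x) * (1 - t * x))))
            \<in> borel_measurable lborel" for n
      using int[of "u n"] u by (auto simp: set_integrable_def)
    show "AE x in lborel. (\<lambda>n. indicator {0<..<1} x *\<^sub>R (x powr (u n + 1 / 2) / sqrt ((1 - x) * (1 - t * x))))
            \<longlonglongrightarrow> indicator {0<..<1} x *\<^sub>R (x powr (c + 1 / 2) / sqrt ((1 - x) * (1 - t * x)))"
    proof (rule AE_I2)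
      fix x :: real
      show "(\<lambda>n. indicator {0<..<1} x *\<^sub>R (x powr (u n + 1 / 2) / sqrt ((1 - x) * (1 - t * x))))
            \<longlonglongrightarrow> indicator {0<..<1} x *\<^sub>R (x powr (c + 1 / 2) / sqrt ((1 - x) * (1 - t * x)))"
      proof (cases "x \<in> {0<..<1}")
        case True
        from weight_pos[OF this assms(2,1)] have "sqrt ((1 - x) * (1 - t * x)) \<noteq> 0" by auto
        with True u show ?thesis by (intro tendsto_intros) auto
      qed simp
    qed
    show "AE x in lborel. norm (indicator {0<..<1} x *\<^sub>R (x powr (u n + 1 / 2) / sqrt ((1 - x) * (1 - t * x))))
       \<le> indicator {0<..<1} x *\<^sub>R (x powr (s + 1 / 2) / sqrt ((1 - x) * (1 - t * x)))" for n
    proof (rule AE_I2)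
      fix x :: real
      show "norm (indicator {0<..<1} x *\<^sub>R (x powr (u n + 1 / 2) / sqrt ((1 - x) * (1 - t * x))))
       \<le> indicator {0<..<1} x *\<^sub>R (x powr (s + 1 / 2) / sqrt ((1 - x) * (1 - t * x)))"
      proof (cases "x \<in> {0<..<1}")
        case True
        from weight_pos[OF this assms(2,1)] have "sqrt ((1 - x) * (1 - t * x)) > 0" by simp
        moreover have "x powr (u n + 1 / 2) \<le> x powr (s + 1 / 2)"
          using True u by (intro powr_mono') auto
        ultimately show ?thesis using True by (simp add: divide_right_mono)
      qed simp
    qed
  qed
qed

section \<open>The kernel as a series of moments\<close>

text \<open>The kernel \<open>K i j\<close> without its elementary factors. The order of the arguments is that of \<open>K\<close>; the
moments with the inverse square root go with the second one.\<close>

definition moment_kernel :: "real \<Rightarrow> real \<Rightarrow> real \<Rightarrow> real" where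
  "moment_kernel t i j =
     (\<Sum>l. t ^ l * (invsqrt_moment t (j + real l) * sqrt_moment t (i + real l)))"

lemma moment_kernel_term_le:
  assumes "0 \<le> t" "t < 1" "i > - 1 / 2" "j0 > - 3 / 2" "j0 \<le> j"
  shows "norm (t ^ l * (invsqrt_moment t (j + real l) * sqrt_moment t (i + real l)))
           \<le> t ^ l * (invsqrt_moment t j0 * sqrt_moment t i)"
proof -
  have "invsqrt_moment t (j + real l) \<le> invsqrt_moment t j0"
    by (rule invsqrt_moment_antimono) (use assms in auto)
  moreover have "sqrt_moment t (i + real l) \<le> sqrt_moment t i"
    by (rule sqrt_moment_antimono) (use assms in auto)
  ultimately show ?thesis
    using assms invsqrt_moment_nonneg[of t] sqrt_moment_nonneg[of t]
    by (auto simp: abs_mult intro!: mult_left_mono mult_mono)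
qed

lemma moment_kernel_sums:
  assumes "0 \<le> t" "t < 1" "i > - 1 / 2" "j > - 3 / 2"
  shows "(\<lambda>l. t ^ l * (invsqrt_moment t (j + real l) * sqrt_moment t (i + real l)))
           sums moment_kernel t i j"
  unfolding moment_kernel_def
proof (rule summable_sums, rule summable_comparison_test')
  show "norm (t ^ l * (invsqrt_moment t (j + real l) * sqrt_moment t (i + real l)))
           \<le> t ^ l * (invsqrt_moment t j * sqrt_moment t i)" for l
    by (rule moment_kernel_term_le) (use assms in auto)
  show "summable (\<lambda>l. t ^ l * (invsqrt_moment t j * sqrt_moment t i))"
    using assms by (intro summable_mult2 summable_geometric) auto
qed

lemma continuous_on_moment_kernel:
  assumes "0 \<le> t" "t < 1" "i > - 1 / 2" "j0 > - 3 / 2"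
  shows "continuous_on {j0..} (moment_kernel t i)"
proof -
  let ?f = "\<lambda>l j. t ^ l * (invsqrt_moment t (j + real l) * sqrt_moment t (i + real l))"
  have "uniform_limit {j0..} (\<lambda>n j. \<Sum>l<n. ?f l j) (\<lambda>j. \<Sum>l. ?f l j) sequentially"
  proof (rule Weierstrass_m_test)
    show "norm (?f l j) \<le> t ^ l * (invsqrt_moment t j0 * sqrt_moment t i)" if "j \<in> {j0..}" for l j
      by (rule moment_kernel_term_le) (use assms that in auto)
    show "summable (\<lambda>l. t ^ l * (invsqrt_moment t j0 * sqrt_moment t i))"
      using assms by (intro summable_mult2 summable_geometric) auto
  qed
  moreover have "continuous_on {j0..} (?f l)" for l
  proof -
    have "continuous_on {j0..} (\<lambda>j. invsqrt_moment t (j + real l))"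
      by (rule continuous_on_compose2[OF continuous_on_invsqrt_moment[OF assms(1,2,4)]])
         (auto intro!: continuous_intros)
    thus ?thesis by (intro continuous_intros)
  qed
  hence "continuous_on {j0..} (\<lambda>j. \<Sum>l<n. ?f l j)" for n
    by (intro continuous_on_sum)
  ultimately have "continuous_on {j0..} (\<lambda>j. \<Sum>l. ?f l j)"
    by (intro uniform_limit_theorem[where F = sequentially]) auto
  thus ?thesis by (simp add: moment_kernel_def[abs_def])
qed

text \<open>A determinant of order two, of consecutive moments at \<open>i\<close> and at \<open>j\<close>. Up to a constant and
Gamma factors, it is the bracket in the definition of the kernel.\<close>

definition moment_wronskian :: "real \<Rightarrow> real \<Rightarrow> real \<Rightarrow> real" where
  "moment_wronskian t i j =
     invsqrt_moment t (i - 1) * invsqrt_moment t j - invsqrt_moment t (j - 1) * invsqrt_moment t i"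

text \<open>A Christoffel-Darboux type identity: the difference under a common shift of both indices is
\<open>j - i\<close> times a product of a function of \<open>j\<close> and a function of \<open>i\<close>.\<close>

lemma moment_wronskian_step:
  assumes "0 \<le> t" "t < 1" "i > - 1 / 2" "j > - 1 / 2"
  shows "(j + 1 / 2) * moment_wronskian t i j
           - t * ((j + 1 + 1 / 2) * moment_wronskian t (i + 1) (j + 1))
         = (j - i) * (invsqrt_moment t j * sqrt_moment t i)"
proof -
  define a0 a1 a2 b where
    "a0 = invsqrt_moment t (i - 1)" "a1 = invsqrt_moment t i" "a2 = invsqrt_moment t (i + 1)"
    "b = sqrt_moment t i"
  define A0 A1 A2 B where
    "A0 = invsqrt_moment t (j - 1)" "A1 = invsqrt_moment t j" "A2 = invsqrt_moment t (j + 1)"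
    "B = sqrt_moment t j"
  note defs = a0_a1_a2_b_def A0_A1_A2_B_def
  \<comment> \<open>The pointwise relation eliminates the moments at \<open>i - 1\<close> and \<open>j - 1\<close>; integration by parts eliminates those at \<open>i + 1\<close> and \<open>j + 1\<close>.\<close>
  have a0: "a0 = b + (1 + t) * a1 - t * a2" and A0: "A0 = B + (1 + t) * A1 - t * A2"
    using sqrt_moment_eq[of t i] sqrt_moment_eq[of t j] assms by (auto simp: defs)
  have a2: "2 * (t * a2) = (1 + t) * a1 - (2 * i + 1) * b"
    and A2: "2 * (t * A2) = (1 + t) * A1 - (2 * j + 1) * B"
    using sqrt_moment_by_parts[of t i] sqrt_moment_by_parts[of t j] assms by (auto simp: defs)
  have "2 * ((j + 1 / 2) * (a0 * A1 - A0 * a1) - t * ((j + 1 + 1 / 2) * (a1 * A2 - A1 * a2)))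
      = (j + 1 / 2) * ((2 * b + 2 * (1 + t) * a1 - 2 * (t * a2)) * A1
                       - (2 * B + 2 * (1 + t) * A1 - 2 * (t * A2)) * a1)
        - (j + 3 / 2) * (a1 * (2 * (t * A2)) - A1 * (2 * (t * a2)))"
    unfolding a0 A0 by (simp add: field_simps)
  also have "\<dots> = 2 * ((j - i) * (A1 * b))"
    unfolding a2 A2 by (simp add: algebra_simps)
  finally show ?thesis
    by (simp add: moment_wronskian_def defs)
qed

lemma moment_kernel_wronskian:
  assumes t: "0 \<le> t" "t < 1" and ij: "i > - 1 / 2" "j > - 1 / 2"
  shows "(j - i) * moment_kernel t i j = (j + 1 / 2) * moment_wronskian t i j"
proof -
  define V where "V N = t ^ N * ((j + real N + 1 / 2) * moment_wronskian t (i + real N) (j + real N))" for N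
  define f where "f l = t ^ l * (invsqrt_moment t (j + real l) * sqrt_moment t (i + real l))" for l
  have step: "V l - V (Suc l) = (j - i) * f l" for l
  proof -
    have "V l - V (Suc l) = t ^ l * ((j + real l + 1 / 2) * moment_wronskian t (i + real l) (j + real l)
      - t * ((j + real l + 1 + 1 / 2) * moment_wronskian t (i + real l + 1) (j + real l + 1)))"
      by (simp add: V_def right_diff_distrib add_ac mult_ac)
    also have "\<dots> = t ^ l * ((j - i) * (invsqrt_moment t (j + real l) * sqrt_moment t (i + real l)))"
      by (subst moment_wronskian_step) (use t ij in auto)
    finally show ?thesis by (simp add: f_def mult_ac)
  qed
  define C where "C = invsqrt_moment t (i - 1) * invsqrt_moment t j
                      + invsqrt_moment t (j - 1) * invsqrt_moment t i"
  have le: "\<bar>moment_wronskian t (i + real N) (j + real N)\<bar> \<le> C" for N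
  proof -
    have a: "invsqrt_moment t (i + real N - 1) \<le> invsqrt_moment t (i - 1)"
      "invsqrt_moment t (i + real N) \<le> invsqrt_moment t i"
      "invsqrt_moment t (j + real N - 1) \<le> invsqrt_moment t (j - 1)"
      "invsqrt_moment t (j + real N) \<le> invsqrt_moment t j"
      by (rule invsqrt_moment_antimono; use t ij in simp)+
    note nn = invsqrt_moment_nonneg[OF t]
    have "\<bar>moment_wronskian t (i + real N) (j + real N)\<bar> \<le>
       invsqrt_moment t (i + real N - 1) * invsqrt_moment t (j + real N)
       + invsqrt_moment t (j + real N - 1) * invsqrt_moment t (i + real N)"
      unfolding moment_wronskian_def
      by (rule order_trans[OF abs_triangle_ineq4]) (simp add: nn)
    also have "\<dots> \<le> C"
      unfolding C_def by (intro add_mono mult_mono a nn)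
    finally show ?thesis .
  qed
  \<comment> \<open>The Wronskian stays bounded, while \<open>t ^ N * (j + N + 1/2)\<close> tends to \<open>0\<close>.\<close>
  have "V \<longlonglongrightarrow> 0"
  proof (rule Lim_null_comparison)
    have "(\<lambda>N. C * (j + 1 / 2) * t ^ N + C * (real N * t ^ N)) \<longlonglongrightarrow> C * (j + 1 / 2) * 0 + C * 0"
      using t powser_times_n_limit_0[of t] by (intro tendsto_intros) auto
    thus "(\<lambda>N. C * (j + 1 / 2) * t ^ N + C * (real N * t ^ N)) \<longlonglongrightarrow> 0" by simp
    show "\<forall>\<^sub>F N in sequentially. norm (V N) \<le> C * (j + 1 / 2) * t ^ N + C * (real N * t ^ N)"
    proof (rule always_eventually, rule allI)
      fix N
      have "norm (V N) \<le> t ^ N * ((j + real N + 1 / 2) * C)"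
        using t ij le[of N] by (auto simp: V_def abs_mult intro!: mult_left_mono)
      thus "norm (V N) \<le> C * (j + 1 / 2) * t ^ N + C * (real N * t ^ N)"
        by (simp add: algebra_simps)
    qed
  qed
  hence "(\<lambda>l. V l - V (Suc l)) sums (V 0 - 0)"
    by (rule telescope_sums')
  hence "(\<lambda>l. (j - i) * f l) sums V 0"
    by (simp add: step)
  moreover have "(\<lambda>l. (j - i) * f l) sums ((j - i) * moment_kernel t i j)"
    unfolding f_def by (intro sums_mult moment_kernel_sums) (use t ij in auto)
  ultimately have "V 0 = (j - i) * moment_kernel t i j" by (rule sums_unique2)
  thus ?thesis by (simp add: V_def)
qed

lemma Beta_pochhammer:
  fixes x d :: real
  assumes "0 < x" "0 < d"
  shows "Beta (x + real m) d = Gamma x * Gamma d / Gamma (x + d) * (pochhammer x m / pochhammer (x + d) m)"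
proof -
  have "x \<notin> \<int>\<^sub>\<le>\<^sub>0" "x + d \<notin> \<int>\<^sub>\<le>\<^sub>0"
    using assms by (auto dest: nonpos_Ints_nonpos)
  hence "pochhammer x m = Gamma (x + real m) / Gamma x"
    "pochhammer (x + d) m = Gamma (x + d + real m) / Gamma (x + d)"
    by (simp_all add: pochhammer_Gamma)
  moreover have "Gamma x > 0" "Gamma (x + d) > 0" "Gamma (x + d + real m) > 0"
    using assms by (auto intro!: Gamma_real_pos)
  ultimately show ?thesis by (simp add: Beta_def field_simps)
qed

text \<open>The two kinds of hypergeometric function in the kernel, in terms of moments. This one rests on
\<open>Beta x (1/2) - Beta (x + 1) (1/2) = Beta x (3/2)\<close>.\<close>

lemma hyp2F1_of_difference:
  assumes t: "0 \<le> t" "t < 1" and y: "y > - 1 / 2"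
  shows "Gamma (y + 1 / 2) / (sqrt pi * Gamma (y + 2)) * hyp2F1 (1 / 2) (y + 1 / 2) (y + 2) t =
         2 / pi * (invsqrt_moment t (y - 1) - invsqrt_moment t y)"
proof -
  define c :: "nat \<Rightarrow> real" where "c m = pochhammer (1 / 2) m / fact m" for m
  have s1: "(\<lambda>m. c m * Beta (y + 1 / 2 + real m) (1 / 2) * t ^ m) sums invsqrt_moment t (y - 1)"
    using invsqrt_moment_sums[of t "y - 1"] t y by (simp add: c_def add_ac)
  have s2: "(\<lambda>m. c m * Beta (y + 1 / 2 + real m + 1) (1 / 2) * t ^ m) sums invsqrt_moment t y"
    using invsqrt_moment_sums[of t y] t y by (simp add: c_def add_ac)
  define K where "K = Gamma (y + 1 / 2) / (sqrt pi * Gamma (y + 2))"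
  have G: "Gamma (3 / 2 :: real) = sqrt pi / 2"
  proof -
    have "(1 / 2 :: real) \<notin> \<int>\<^sub>\<le>\<^sub>0" by (auto dest: nonpos_Ints_nonpos)
    thus ?thesis using Gamma_plus1[of "1 / 2 :: real"] by (simp add: Gamma_one_half_real)
  qed
  have pi: "sqrt pi * sqrt pi = pi" "sqrt pi > 0" by simp_all
  have coeff: "2 / pi * (c m * Beta (y + 1 / 2 + real m) (1 / 2) * t ^ m
                - c m * Beta (y + 1 / 2 + real m + 1) (1 / 2) * t ^ m) =
         K * (pochhammer (1 / 2) m * pochhammer (y + 1 / 2) m / (pochhammer (y + 2) m * fact m) * t ^ m)" for m
  proof -
    have nz: "y + 1 / 2 + real m > 0" using y by simp
    have "Beta (y + 1 / 2 + real m) (1 / 2) - Beta (y + 1 / 2 + real m + 1) (1 / 2)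
          = Beta (y + 1 / 2 + real m) (3 / 2)"
      using Beta_plus1_plus1[of "y + 1 / 2 + real m" "1 / 2 :: real"] nz
      by (force dest: nonpos_Ints_nonpos)
    also have "\<dots> = Gamma (y + 1 / 2) * (sqrt pi / 2) / Gamma (y + 2)
         * (pochhammer (y + 1 / 2) m / pochhammer (y + 2) m)"
      using Beta_pochhammer[of "y + 1 / 2" "3 / 2" m] y by (simp add: G add_ac)
    also have "\<dots> = pi / 2 * K * (pochhammer (y + 1 / 2) m / pochhammer (y + 2) m)"
    proof -
      have "pi / 2 * (x / (sqrt pi * z)) = x * (pi / sqrt pi / 2) / z" for x z :: real
        by (simp add: mult_ac)
      thus ?thesis unfolding K_def by (simp add: real_div_sqrt)
    qed
    finally have e: "Beta (y + 1 / 2 + real m) (1 / 2) - Beta (y + 1 / 2 + real m + 1) (1 / 2)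
       = pi / 2 * K * (pochhammer (y + 1 / 2) m / pochhammer (y + 2) m)" .
    have "2 / pi * (c m * Beta (y + 1 / 2 + real m) (1 / 2) * t ^ m
                - c m * Beta (y + 1 / 2 + real m + 1) (1 / 2) * t ^ m)
       = 2 / pi * c m * t ^ m * (Beta (y + 1 / 2 + real m) (1 / 2) - Beta (y + 1 / 2 + real m + 1) (1 / 2))"
      by (simp add: algebra_simps)
    also have "\<dots> = K * (pochhammer (1 / 2) m * pochhammer (y + 1 / 2) m / (pochhammer (y + 2) m * fact m) * t ^ m)"
      unfolding e by (simp add: c_def mult_ac)
    finally show ?thesis .
  qed
  have "(\<lambda>m. K * (pochhammer (1 / 2) m * pochhammer (y + 1 / 2) m / (pochhammer (y + 2) m * fact m) * t ^ m))
     sums (2 / pi * (invsqrt_moment t (y - 1) - invsqrt_moment t y))"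
    using sums_mult[OF sums_diff[OF s1 s2], of "2 / pi"] by (simp only: coeff)
  moreover have "K \<noteq> 0"
  proof -
    have "Gamma (y + 1 / 2) > 0" "Gamma (y + 2) > 0" using y by (auto intro!: Gamma_real_pos)
    thus ?thesis using pi by (simp add: K_def)
  qed
  ultimately have "(\<lambda>m. pochhammer (1 / 2) m * pochhammer (y + 1 / 2) m / (pochhammer (y + 2) m * fact m) * t ^ m)
     sums (2 / pi * (invsqrt_moment t (y - 1) - invsqrt_moment t y) / K)"
    using sums_mult[of _ _ "1 / K"] by (fastforce simp: mult.assoc)
  hence "hyp2F1 (1 / 2) (y + 1 / 2) (y + 2) t =
           2 / pi * (invsqrt_moment t (y - 1) - invsqrt_moment t y) / K"
    by (simp only: hyp2F1_series sums_unique[symmetric])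
  thus ?thesis using \<open>K \<noteq> 0\<close> unfolding K_def[symmetric] by simp
qed

text \<open>Here \<open>b = y + 3/2\<close> exceeds \<open>c = y + 1\<close>, so Euler's integral does not apply directly. The factor
\<open>1 - t\<close> compensates for this, and the identity is verified coefficient by coefficient in \<open>t\<close>.\<close>

lemma hyp2F1_of_combination:
  assumes t: "0 \<le> t" "t < 1" and y: "y > - 1 / 2"
  shows "(1 - t) * (Gamma (y + 1 / 2) / (sqrt pi * Gamma (y + 1))
            * hyp2F1 (1 / 2) (y + 3 / 2) (y + 1) t) =
         1 / pi * (invsqrt_moment t (y - 1) - t * invsqrt_moment t y)"
proof -
  define a :: "nat \<Rightarrow> real" where "a m = pochhammer (1 / 2) m / fact m" for m
  define c :: "nat \<Rightarrow> real"
    where "c m = pochhammer (1 / 2) m * pochhammer (y + 3 / 2) m / (pochhammer (y + 1) m * fact m)" for m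
  define K where "K = Gamma (y + 1 / 2) / (sqrt pi * Gamma (y + 1))"
  define B where "B m = Beta (y + 1 / 2 + real m) (1 / 2)" for m
  have pos: "pochhammer (y + 1) m > 0" "pochhammer (y + 3 / 2) m > 0" "pochhammer (1 / 2 :: real) m > 0" for m
    using y by (auto intro!: pochhammer_pos)
  have pi: "sqrt pi * sqrt pi = pi" "sqrt pi > 0" by simp_all
  have Gpos: "Gamma (y + 1 / 2) > 0" "Gamma (y + 1) > 0" using y by (auto intro!: Gamma_real_pos)
  have B: "B m = pi * K * (pochhammer (y + 1 / 2) m / pochhammer (y + 1) m)" for m
  proof -
    have "B m = Gamma (y + 1 / 2) * sqrt pi / Gamma (y + 1) * (pochhammer (y + 1 / 2) m / pochhammer (y + 1) m)"
      using Beta_pochhammer[of "y + 1 / 2" "1 / 2" m] y by (simp add: B_def Gamma_one_half_real add_ac)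
    also have "Gamma (y + 1 / 2) * sqrt pi / Gamma (y + 1) = pi * K"
      unfolding K_def using pi Gpos by (simp add: field_simps)
    finally show ?thesis .
  qed
  have s1: "(\<lambda>m. a m * B m * t ^ m) sums invsqrt_moment t (y - 1)"
    using invsqrt_moment_sums[of t "y - 1"] t y by (simp add: a_def B_def add_ac)
  have s2: "(\<lambda>m. a m * B (Suc m) * t ^ m) sums invsqrt_moment t y"
    using invsqrt_moment_sums[of t y] t y by (simp add: a_def B_def add_ac)
  have "(\<lambda>m. a (Suc m) * B (Suc m) * t ^ Suc m) sums (invsqrt_moment t (y - 1) - a 0 * B 0 * t ^ 0)"
    using s1 by (subst sums_Suc_iff) simp
  from sums_diff[OF this sums_mult[OF s2, of t]]
  have sA: "(\<lambda>m. (a (Suc m) - a m) * B (Suc m) * t ^ Suc m)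
      sums (invsqrt_moment t (y - 1) - t * invsqrt_moment t y - pi * K)"
    by (simp add: a_def B algebra_simps)
  have a_Suc: "a (Suc m) = a m * ((1 / 2 + real m) / (1 + real m))" for m
    unfolding a_def pochhammer_Suc fact_Suc by (simp add: field_simps)
  have c_Suc: "c (Suc m) = c m * ((1 / 2 + real m) * (y + 3 / 2 + real m) / ((y + 1 + real m) * (1 + real m)))" for m
    unfolding c_def pochhammer_Suc fact_Suc by (simp add: field_simps)
  have c_a: "a m * (pochhammer (y + 1 / 2) (Suc m) / pochhammer (y + 1) (Suc m))
              = c m * ((y + 1 / 2) / (y + 1 + real m))" for m
  proof -
    have "pochhammer (y + 1 / 2) (Suc m) = (y + 1 / 2) * pochhammer (y + 3 / 2) m"
      by (simp add: pochhammer_rec add_ac)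
    moreover have "A / f * (e * Q / (R * d)) = A * Q / (R * f) * (e / d)" for A f e Q R d :: real
      by (simp add: mult_ac)
    ultimately show ?thesis unfolding a_def c_def pochhammer_Suc[of "y + 1"] by (simp only:)
  qed
  have coeff: "(a (Suc m) - a m) * B (Suc m) = pi * K * (c (Suc m) - c m)" for m
  proof -
    have nz: "y + 1 + real m \<noteq> 0" "1 + real m \<noteq> 0" using y by auto
    have "(a (Suc m) - a m) * B (Suc m) = pi * K * (a m * (pochhammer (y + 1 / 2) (Suc m) / pochhammer (y + 1) (Suc m)))
            * ((1 / 2 + real m) / (1 + real m) - 1)"
      unfolding B a_Suc by (simp add: algebra_simps)
    also have "\<dots> = pi * K * c m * (((y + 1 / 2) / (y + 1 + real m)) * ((1 / 2 + real m) / (1 + real m) - 1))"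
      unfolding c_a by (simp add: mult_ac)
    also have "((y + 1 / 2) / (y + 1 + real m)) * ((1 / 2 + real m) / (1 + real m) - 1)
        = (1 / 2 + real m) * (y + 3 / 2 + real m) / ((y + 1 + real m) * (1 + real m)) - 1"
    proof -
      define Y M where "Y = y + 1 + real m" and "M = 1 + real m"
      have "Y \<noteq> 0" "M \<noteq> 0" using nz by (auto simp: Y_def M_def)
      moreover have e: "y + 1 / 2 = Y - M + 1 / 2" "1 / 2 + real m = M - 1 / 2" "y + 3 / 2 + real m = Y + 1 / 2"
        by (simp_all add: Y_def M_def)
      ultimately show ?thesis unfolding Y_def[symmetric] M_def[symmetric] e by (simp add: divide_simps) (simp add: algebra_simps)
    qed
    finally show ?thesis unfolding c_Suc by (simp add: algebra_simps)
  qed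
  \<comment> \<open>Consecutive coefficients have a quotient at most \<open>1\<close>, because \<open>y > - 1/2\<close>.\<close>
  have sumc: "summable (\<lambda>m. c m * t ^ m)"
  proof (rule summable_ratio_test)
    show "t < 1" by fact
    fix m :: nat
    have "(1 / 2 + real m) * (y + 3 / 2 + real m) \<le> (y + 1 + real m) * (1 + real m)"
      using y by (simp add: algebra_simps)
    moreover have d: "0 < (y + 1 + real m) * (1 + real m)" using y by simp
    ultimately have r: "(1 / 2 + real m) * (y + 3 / 2 + real m) / ((y + 1 + real m) * (1 + real m)) \<le> 1"
      by (simp only: divide_le_eq_1_pos)
    have c0: "0 \<le> c n" for n unfolding c_def using pos[of n] by (intro divide_nonneg_pos) auto
    have "c (Suc m) \<le> c m"
      unfolding c_Suc by (rule mult_left_le[OF r c0])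
    hence "c (Suc m) * t ^ Suc m \<le> c m * t ^ Suc m"
      using t by (intro mult_right_mono) auto
    thus "norm (c (Suc m) * t ^ Suc m) \<le> t * norm (c m * t ^ m)"
      using c0 t by (simp add: abs_mult mult_ac)
  qed
  define F where "F = hyp2F1 (1 / 2) (y + 3 / 2) (y + 1) t"
  have F: "(\<lambda>m. c m * t ^ m) sums F"
    using sumc by (simp add: F_def hyp2F1_series c_def summable_sums)
  hence "(\<lambda>m. c (Suc m) * t ^ Suc m) sums (F - c 0 * t ^ 0)"
    by (subst sums_Suc_iff) simp
  from sums_mult[OF sums_diff[OF this sums_mult[OF F, of t]], of "pi * K"]
  have "(\<lambda>m. pi * K * (c (Suc m) - c m) * t ^ Suc m) sums (pi * K * (F - 1 - t * F))"
    by (simp add: c_def[of 0] algebra_simps)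
  hence "(\<lambda>m. (a (Suc m) - a m) * B (Suc m) * t ^ Suc m) sums (pi * K * (F - 1 - t * F))"
    by (simp only: coeff)
  from sums_unique2[OF this sA]
  have "pi * ((1 - t) * (K * F)) = invsqrt_moment t (y - 1) - t * invsqrt_moment t y"
    by (simp add: algebra_simps)
  hence "(1 - t) * (K * F) = 1 / pi * (invsqrt_moment t (y - 1) - t * invsqrt_moment t y)"
    by (simp add: field_simps)
  thus ?thesis by (simp add: K_def F_def)
qed

text \<open>Apart from \<open>1 / (i - j)\<close>, the prefactor of the kernel is \<open>- (j + 1/2) / 2\<close> times an expression
symmetric in \<open>i\<close> and \<open>j\<close>, and this \<open>j + 1/2\<close> is the one that appears in \<open>moment_kernel_wronskian\<close>.\<close>

lemma kernel_real_eq: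
  assumes t: "0 < t" "t < 1" and ij: "i > - 1 / 2" "j > - 1 / 2" "i \<noteq> j"
  shows "kernel_real t i j = - (t powr ((i + j) / 2 + 1) / pi\<^sup>2 * moment_kernel t i j)"
proof -
  define u v where "u y = Gamma (y + 1 / 2) / (sqrt pi * Gamma (y + 1)) * hyp2F1 (1 / 2) (y + 3 / 2) (y + 1) t"
    and "v y = Gamma (y + 1 / 2) / (sqrt pi * Gamma (y + 2)) * hyp2F1 (1 / 2) (y + 1 / 2) (y + 2) t" for y
  define a where "a = invsqrt_moment t"
  have uv: "u y = (a (y - 1) - t * a y) / (pi * (1 - t))" "v y = 2 / pi * (a (y - 1) - a y)"
    if "y > - 1 / 2" for y
    using hyp2F1_of_combination[of t y] hyp2F1_of_difference[of t y] t that
    by (auto simp: u_def v_def a_def field_simps)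
  have W: "u i * v j - u j * v i = - 2 / pi\<^sup>2 * moment_wronskian t i j"
  proof -
    have "u i * v j - u j * v i = 2 / (pi\<^sup>2 * (1 - t)) *
        ((a (i - 1) - t * a i) * (a (j - 1) - a j) - (a (j - 1) - t * a j) * (a (i - 1) - a i))"
    proof -
      have "p / (w * c) * (2 / w * q) - p' / (w * c) * (2 / w * q') = 2 / (w\<^sup>2 * c) * (p * q - p' * q')"
        for p p' q q' w c :: real
        by (simp add: power2_eq_square diff_divide_distrib right_diff_distrib mult_ac)
      thus ?thesis unfolding uv[OF ij(1)] uv[OF ij(2)] .
    qed
    also have "(a (i - 1) - t * a i) * (a (j - 1) - a j) - (a (j - 1) - t * a j) * (a (i - 1) - a i)
       = (1 - t) * - moment_wronskian t i j"
      by (simp add: moment_wronskian_def a_def algebra_simps)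
    finally show ?thesis using t by simp
  qed
  have nn: "y \<notin> \<int>\<^sub>\<le>\<^sub>0" if "y > 0" for y :: real
    using that by (auto dest: nonpos_Ints_nonpos)
  have half: "(- 1 / 2 :: real) \<notin> \<int>\<^sub>\<le>\<^sub>0"
  proof
    assume "(- 1 / 2 :: real) \<in> \<int>\<^sub>\<le>\<^sub>0"
    then obtain k :: int where "(- 1 / 2 :: real) = of_int k"
      by (auto elim!: nonpos_Ints_cases)
    hence "of_int (2 * k) = (of_int (- 1) :: real)" by simp
    thus False unfolding of_int_eq_iff by presburger
  qed
  have "Gamma (- 1 / 2 :: real) = - 2 * sqrt pi"
    using Gamma_plus1[OF half] by (simp add: Gamma_one_half_real)
  hence p1: "poch (- 1 / 2) (i + 1) = - Gamma (i + 1 / 2) / (2 * sqrt pi)"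
    by (simp add: poch_def add_ac)
  have p2: "poch (1 / 2) (j + 1) = (j + 1 / 2) * Gamma (j + 1 / 2) / sqrt pi"
    using Gamma_plus1[of "j + 1 / 2"] ij nn[of "j + 1 / 2"]
    by (simp add: poch_def Gamma_one_half_real add_ac)
  have g: "Gamma (y + 2) = (y + 1) * Gamma (y + 1)" if "y > - 1 / 2" for y :: real
    using Gamma_plus1[of "y + 1"] nn[of "y + 1"] that by (simp add: add_ac)
  define T where "T = t powr ((i + j) / 2 + 1)"
  define F1 F2 F3 F4 where "F1 = hyp2F1 (1 / 2) (i + 3 / 2) (i + 1) t"
    "F2 = hyp2F1 (1 / 2) (j + 1 / 2) (j + 2) t" "F3 = hyp2F1 (1 / 2) (j + 3 / 2) (j + 1) t"
    "F4 = hyp2F1 (1 / 2) (i + 1 / 2) (i + 2) t"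
  note Fs = F1_F2_F3_F4_def
  have "kernel_real t i j = - T * (j + 1 / 2) / (2 * (i - j)) * (u i * v j - u j * v i)"
  proof -
    have uv': "G / (w * H) * P * (G' / (w * (c * H')) * Q) = G * G' / ((w * w) * H * H') * (1 / c * P * Q)"
      for G G' H H' P Q c w :: real by (simp add: mult_ac)
    have 1: "u i * v j = Gamma (i + 1 / 2) * Gamma (j + 1 / 2)
               / ((sqrt pi * sqrt pi) * Gamma (i + 1) * Gamma (j + 1)) * (1 / (j + 1) * F1 * F2)"
      unfolding u_def v_def Fs g[OF ij(2)] by (rule uv')
    have 2: "u j * v i = Gamma (i + 1 / 2) * Gamma (j + 1 / 2)
               / ((sqrt pi * sqrt pi) * Gamma (i + 1) * Gamma (j + 1)) * (1 / (i + 1) * F3 * F4)"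
      unfolding u_def v_def Fs g[OF ij(1)] uv' by (simp only: mult_ac)
    have "kernel_real t i j = - Gamma (i + 1 / 2) / (2 * sqrt pi) * ((j + 1 / 2) * Gamma (j + 1 / 2) / sqrt pi)
        / (Gamma (i + 1) * Gamma (j + 1)) * T * (1 / (i - j)) *
        (1 / (j + 1) * F1 * F2 - 1 / (i + 1) * F3 * F4)"
      unfolding kernel_real_def p1 p2 T_def Fs ..
    also have "\<dots> = - T * (j + 1 / 2) / (2 * (i - j)) *
        (Gamma (i + 1 / 2) * Gamma (j + 1 / 2) / ((sqrt pi * sqrt pi) * Gamma (i + 1) * Gamma (j + 1))
           * (1 / (j + 1) * F1 * F2 - 1 / (i + 1) * F3 * F4))"
      proof -
        have "- G / (2 * w) * (c * G' / w) / (H * H') * T * (1 / d) * R =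
              - T * c / (2 * d) * (G * G' / ((w * w) * H * H') * R)" for G G' H H' R c d w :: real
          by (simp add: mult_ac)
        thus ?thesis .
      qed
    also have "\<dots> = - T * (j + 1 / 2) / (2 * (i - j)) * (u i * v j - u j * v i)"
      unfolding 1 2 by (simp only: right_diff_distrib)
    finally show ?thesis .
  qed
  also have "\<dots> = T / pi\<^sup>2 / (i - j) * ((j + 1 / 2) * moment_wronskian t i j)"
  proof -
    have "- T * A / (2 * d) * (- 2 / w * V) = T / w / d * (A * V)" for A V d w :: real
      by (simp add: mult_ac)
    thus ?thesis unfolding W .
  qed
  also have "\<dots> = T / pi\<^sup>2 / (i - j) * ((j - i) * moment_kernel t i j)"
    using moment_kernel_wronskian[of t i j] t ij by simp
  also have "\<dots> = - (T / pi\<^sup>2 * moment_kernel t i j)"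
    using ij by (simp add: field_simps)
  finally show ?thesis by (simp add: T_def)
qed

lemma kernel_eq:
  assumes t: "0 < t" "t < 1"
  shows "kernel t i j = - (t powr ((real i + real j) / 2 + 1) / pi\<^sup>2 * moment_kernel t (real i) (real j))"
proof (cases "i = j")
  case False
  thus ?thesis using kernel_real_eq[of t "real i" "real j"] t by (simp add: kernel_def)
next
  case True
  \<comment> \<open>The right-hand side is continuous in the second index, so it takes the value of the limit.\<close>
  let ?g = "\<lambda>y. - (t powr ((real i + y) / 2 + 1) / pi\<^sup>2 * moment_kernel t (real i) y)"
  have "continuous_on {- 1 / 4..} ?g"
    by (intro continuous_intros continuous_on_moment_kernel) (use t in auto)
  hence "continuous_on {- 1 / 4<..} ?g"
    by (rule continuous_on_subset) auto
  hence "isCont ?g (real i)"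
    by (subst (asm) continuous_on_eq_continuous_at) auto
  hence "(?g \<longlongrightarrow> ?g (real i)) (at (real i))"
    by (simp add: isCont_def)
  moreover have "eventually (\<lambda>y. y \<in> {- 1 / 4<..} - {real i}) (at (real i))"
    by (rule eventually_at_in_open) auto
  hence "eventually (\<lambda>y. ?g y = kernel_real t (real i) y) (at (real i))"
    by eventually_elim (use t in \<open>auto simp: kernel_real_eq\<close>)
  ultimately have "((\<lambda>y. kernel_real t (real i) y) \<longlongrightarrow> ?g (real i)) (at (real i))"
    by (rule Lim_transform_eventually)
  hence "Lim (at (real i)) (\<lambda>y. kernel_real t (real i) y) = ?g (real i)"
    by (intro tendsto_Lim) auto
  thus ?thesis using True by (simp add: kernel_def)
qed

section \<open>The Cauchy determinant\<close>

lemma det_mat_leibniz: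
  fixes A :: "nat \<Rightarrow> nat \<Rightarrow> 'a :: comm_ring_1"
  shows "Determinant.det (mat n n (\<lambda>(i, j). A i j)) =
      (\<Sum>p | p permutes {0..<n}. signof p * (\<Prod>i = 0..<n. A i (p i)))"
proof -
  have "(\<Prod>i = 0..<n. mat n n (\<lambda>(i, j). A i j) $$ (i, p i)) = (\<Prod>i = 0..<n. A i (p i))"
    if "p permutes {0..<n}" for p
  proof (rule prod.cong)
    fix i assume "i \<in> {0..<n}"
    moreover from this have "p i \<in> {0..<n}" using permutes_in_image[OF that] by simp
    ultimately show "mat n n (\<lambda>(i, j). A i j) $$ (i, p i) = A i (p i)" by simp
  qed simp
  thus ?thesis
    by (subst det_def'[of _ n]) (auto intro!: sum.cong)
qed

lemma det_row_col_scale: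
  fixes A :: "nat \<Rightarrow> nat \<Rightarrow> 'a :: comm_ring_1"
  shows "Determinant.det (mat n n (\<lambda>(i, j). r i * c j * A i j)) =
         (\<Prod>i<n. r i) * (\<Prod>j<n. c j) * Determinant.det (mat n n (\<lambda>(i, j). A i j))"
proof -
  have leibniz: "Determinant.det (mat n n (\<lambda>(i, j). B i j)) =
      (\<Sum>p | p permutes {0..<n}. signof p * (\<Prod>i = 0..<n. B i (p i)))" for B :: "nat \<Rightarrow> nat \<Rightarrow> 'a"
    by (rule det_mat_leibniz)
  have "(\<Prod>i = 0..<n. r i * c (p i) * A i (p i)) =
        (\<Prod>i<n. r i) * (\<Prod>j<n. c j) * (\<Prod>i = 0..<n. A i (p i))" if "p permutes {0..<n}" for p
  proof -
    have "(\<Prod>i = 0..<n. c (p i)) = (\<Prod>i = 0..<n. c i)"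
      using prod.permute[OF that, of c] by (simp add: o_def)
    thus ?thesis by (simp add: prod.distrib lessThan_atLeast0)
  qed
  hence "(\<Sum>p | p permutes {0..<n}. signof p * (\<Prod>i = 0..<n. r i * c (p i) * A i (p i))) =
         (\<Sum>p | p permutes {0..<n}. (\<Prod>i<n. r i) * (\<Prod>j<n. c j) * (signof p * (\<Prod>i = 0..<n. A i (p i))))"
    by (intro sum.cong refl) (simp add: mult_ac)
  thus ?thesis
    unfolding leibniz by (simp add: sum_distrib_left)
qed

text \<open>Elimination of the last row and column, by factoring the matrix into an upper and a lower block
triangular one.\<close>

lemma det_schur_complement:
  fixes A :: "nat \<Rightarrow> nat \<Rightarrow> 'a :: field"
  assumes "A n n \<noteq> 0"
  shows "Determinant.det (mat (Suc n) (Suc n) (\<lambda>(i, j). A i j)) =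
         A n n * Determinant.det (mat n n (\<lambda>(i, j). A i j - A i n * A n j / A n n))"
proof -
  define L where "L = four_block_mat (1\<^sub>m n) (mat n 1 (\<lambda>(i, j). A i n / A n n)) (0\<^sub>m 1 n) (1\<^sub>m 1)"
  define U where "U = four_block_mat (mat n n (\<lambda>(i, j). A i j - A i n * A n j / A n n)) (0\<^sub>m n 1)
                        (mat 1 n (\<lambda>(i, j). A n j)) (mat 1 1 (\<lambda>(i, j). A n n))"
  have "L * U = four_block_mat (mat n n (\<lambda>(i, j). A i j)) (mat n 1 (\<lambda>(i, j). A i n))
                  (mat 1 n (\<lambda>(i, j). A n j)) (mat 1 1 (\<lambda>(i, j). A n n))"
    unfolding L_def U_def
    by (subst mult_four_block_mat[of _ n n _ 1 _ 1 _ _ n _ 1])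
       (use assms in \<open>auto intro!: arg_cong4[where f = four_block_mat] eq_matI simp: scalar_prod_def\<close>)
  also have "\<dots> = mat (Suc n) (Suc n) (\<lambda>(i, j). A i j)"
    by (rule eq_matI) (auto simp: less_Suc_eq)
  finally have "Determinant.det (mat (Suc n) (Suc n) (\<lambda>(i, j). A i j)) = Determinant.det (L * U)"
    by simp
  also have "\<dots> = Determinant.det L * Determinant.det U"
    by (rule det_mult[of _ "n + 1"]) (auto simp: L_def U_def)
  also have "Determinant.det L = Determinant.det (1\<^sub>m n :: 'a mat) * Determinant.det (1\<^sub>m 1 :: 'a mat)"
    unfolding L_def by (rule det_four_block_mat_lower_left_zero) auto
  also have "Determinant.det U = Determinant.det (mat n n (\<lambda>(i, j). A i j - A i n * A n j / A n n))
                * Determinant.det (mat 1 1 (\<lambda>(i, j). A n n))"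
    unfolding U_def by (rule det_four_block_mat_upper_right_zero) auto
  also have "Determinant.det (mat 1 1 (\<lambda>(i, j). A n n)) = A n n"
    by (subst det_single) auto
  finally show ?thesis by simp
qed

text \<open>The Schur complement of the last diagonal entry is again a Cauchy matrix, with row \<open>i\<close> and column
\<open>j\<close> multiplied by factors \<open>r i\<close> and \<open>c j\<close>; the formula follows by induction.\<close>

lemma cauchy_det:
  fixes a b :: "nat \<Rightarrow> 'a :: field"
  assumes "\<And>i j. i < n \<Longrightarrow> j < n \<Longrightarrow> a i * b j \<noteq> 1"
  shows "Determinant.det (mat n n (\<lambda>(i, j). 1 / (1 - a i * b j))) =
         (\<Prod>j<n. \<Prod>i<j. (a i - a j) * (b i - b j)) / (\<Prod>i<n. \<Prod>j<n. (1 - a i * b j))"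
  using assms
proof (induction n)
  case 0
  show ?case by (simp add: det_dim_zero)
next
  case (Suc n)
  have nz: "1 - a i * b j \<noteq> 0" if "i \<le> n" "j \<le> n" for i j
    using Suc.prems[of i j] that by auto
  define r c where "r i = (a i - a n) / (1 - a i * b n)" and "c j = (b j - b n) / (1 - a n * b j)" for i j
  have entry: "1 / (1 - a i * b j) - 1 / (1 - a i * b n) * (1 / (1 - a n * b j)) / (1 / (1 - a n * b n))
               = r i * c j * (1 / (1 - a i * b j))" if "i < n" "j < n" for i j
    using nz[of i j] nz[of i n] nz[of n j] that
    by (simp add: r_def c_def divide_simps) (simp add: algebra_simps)
  have "Determinant.det (mat (Suc n) (Suc n) (\<lambda>(i, j). 1 / (1 - a i * b j))) =
        1 / (1 - a n * b n) *
        Determinant.det (mat n n (\<lambda>(i, j). r i * c j * (1 / (1 - a i * b j))))"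
  proof -
    have "mat n n (\<lambda>(i, j). r i * c j * (1 / (1 - a i * b j))) =
       mat n n (\<lambda>(i, j). 1 / (1 - a i * b j) -
          1 / (1 - a i * b n) * (1 / (1 - a n * b j)) / (1 / (1 - a n * b n)))"
      by (intro cong_mat refl) (simp only: prod.case entry)
    thus ?thesis
      using det_schur_complement[of "\<lambda>i j. 1 / (1 - a i * b j)" n] nz[of n n] by simp
  qed
  also have "Determinant.det (mat n n (\<lambda>(i, j). r i * c j * (1 / (1 - a i * b j)))) =
     (\<Prod>i<n. r i) * (\<Prod>j<n. c j) *
     ((\<Prod>j<n. \<Prod>i<j. (a i - a j) * (b i - b j)) / (\<Prod>i<n. \<Prod>j<n. (1 - a i * b j)))"
    unfolding det_row_col_scale using Suc.IH Suc.prems by simp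
  finally have 1: "Determinant.det (mat (Suc n) (Suc n) (\<lambda>(i, j). 1 / (1 - a i * b j))) =
     1 / (1 - a n * b n) * ((\<Prod>i<n. r i) * (\<Prod>j<n. c j) *
     ((\<Prod>j<n. \<Prod>i<j. (a i - a j) * (b i - b j)) / (\<Prod>i<n. \<Prod>j<n. (1 - a i * b j))))" .
  show ?case
    unfolding 1 r_def c_def prod_dividef prod.lessThan_Suc prod.distrib
    by (simp add: mult_ac)
qed

section \<open>Integration over the cube, one pair of permutations at a time\<close>

text \<open>The factors of the integrand that involve a single variable of odd or even index. The indicator
functions of the unit interval turn the integral over the cube into one over the whole
space.\<close>

definition odd_weight :: "real \<Rightarrow> real \<Rightarrow> real" where
  "odd_weight t x = indicator {0<..<1} x / sqrt ((1 - t * x) * (inverse x - 1))"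

definition even_weight :: "real \<Rightarrow> real \<Rightarrow> real" where
  "even_weight t x = indicator {0<..<1} x * sqrt ((1 - t * x) * (inverse x - 1))"

lemma sqrt_weight_factor:
  fixes x t :: real
  assumes "x \<in> {0<..<1}"
  shows "sqrt ((1 - t * x) * (inverse x - 1)) = sqrt ((1 - x) * (1 - t * x)) / sqrt x"
proof -
  have "(1 - t * x) * (inverse x - 1) = (1 - x) * (1 - t * x) / x"
    using assms by (simp add: field_simps)
  thus ?thesis by (simp add: real_sqrt_divide)
qed

lemma
  assumes "0 \<le> t" "t < 1"
  shows odd_weight_nonneg: "0 \<le> odd_weight t x" and even_weight_nonneg: "0 \<le> even_weight t x"
proof -
  have "0 \<le> odd_weight t x \<and> 0 \<le> even_weight t x"
  proof (cases "x \<in> {0<..<1}")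
    case True
    define q where "q = sqrt ((1 - x) * (1 - t * x)) / sqrt x"
    have "0 \<le> q"
      unfolding q_def using weight_pos[OF True assms(2,1)] True by (intro divide_nonneg_nonneg) auto
    thus ?thesis
      unfolding odd_weight_def even_weight_def sqrt_weight_factor[OF True] q_def[symmetric]
      using True by simp
  qed (simp add: odd_weight_def even_weight_def)
  thus "0 \<le> odd_weight t x" "0 \<le> even_weight t x" by auto
qed

lemma powr_nat_plus_half:
  fixes x :: real
  assumes "0 < x"
  shows "x powr (real k + 1 / 2) = x ^ k * sqrt x" "x powr (real k - 1 / 2) = x ^ k / sqrt x"
  using assms by (simp_all add: powr_add powr_diff powr_realpow powr_half_sqrt)

lemma odd_weight_moment:
  assumes "0 \<le> t" "t < 1"
  shows "has_bochner_integral lborel (\<lambda>x. odd_weight t x * x ^ k) (invsqrt_moment t (real k))"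
proof -
  have "odd_weight t x * x ^ k =
         indicator {0<..<1} x *\<^sub>R (x powr (real k + 1 / 2) / sqrt ((1 - x) * (1 - t * x)))" for x
    by (cases "x \<in> {0<..<1}")
       (auto simp: odd_weight_def sqrt_weight_factor powr_nat_plus_half)
  thus ?thesis
    using invsqrt_moment_integrable[OF assms, of "real k"]
    by (simp add: has_bochner_integral_iff set_integrable_def invsqrt_moment_def
        set_lebesgue_integral_def)
qed

lemma even_weight_moment:
  assumes "0 \<le> t" "t < 1"
  shows "has_bochner_integral lborel (\<lambda>x. even_weight t x * x ^ k) (sqrt_moment t (real k))"
proof -
  have "even_weight t x * x ^ k =
         indicator {0<..<1} x *\<^sub>R (x powr (real k - 1 / 2) * sqrt ((1 - x) * (1 - t * x)))" for x
    by (cases "x \<in> {0<..<1}")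
       (auto simp: even_weight_def sqrt_weight_factor powr_nat_plus_half)
  thus ?thesis
    using sqrt_moment_integrable[OF assms, of "real k"]
    by (simp add: has_bochner_integral_iff set_integrable_def sqrt_moment_def
        set_lebesgue_integral_def)
qed

text \<open>The variables \<open>x 1, \<dots>, x (2 * p)\<close> are split into \<open>x (2 * j + 1)\<close> and \<open>x (2 * j + 2)\<close> for
\<open>j < p\<close>.\<close>

lemma prod_odd_even:
  fixes f :: "nat \<Rightarrow> 'a :: comm_monoid_mult"
  shows "(\<Prod>i=1..2*p. f i) = (\<Prod>j<p. f (2 * j + 1)) * (\<Prod>j<p. f (2 * j + 2))"
  by (induction p) (simp_all add: mult_ac)

lemma monomial_integral:
  fixes k l :: "nat \<Rightarrow> nat"
  assumes t: "0 \<le> t" "t < 1"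
  shows "has_bochner_integral (PiM {1..2*p} (\<lambda>_. lborel))
     (\<lambda>x. (\<Prod>j<p. odd_weight t (x (2 * j + 1)) * x (2 * j + 1) ^ k j)
          * (\<Prod>j<p. even_weight t (x (2 * j + 2)) * x (2 * j + 2) ^ l j))
     ((\<Prod>j<p. invsqrt_moment t (real (k j))) * (\<Prod>j<p. sqrt_moment t (real (l j))))"
proof -
  interpret product_sigma_finite "\<lambda>_ :: nat. lborel :: real measure"
    by standard
  define f where "f i = (if odd i then (\<lambda>x. odd_weight t x * x ^ k (i div 2))
                         else (\<lambda>x. even_weight t x * x ^ l (i div 2 - 1)))" for i :: nat
  define c where "c i = (if odd i then invsqrt_moment t (real (k (i div 2)))
                         else sqrt_moment t (real (l (i div 2 - 1))))" for i :: nat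
  have f: "has_bochner_integral lborel (f i) (c i)" for i
    using odd_weight_moment[OF t] even_weight_moment[OF t] by (simp add: f_def c_def)
  have "integrable (PiM {1..2*p} (\<lambda>_. lborel)) (\<lambda>x. \<Prod>i\<in>{1..2*p}. f i (x i))"
    by (rule product_integrable_prod) (use f in \<open>auto simp: has_bochner_integral_iff\<close>)
  moreover have "(\<integral>x. (\<Prod>i\<in>{1..2*p}. f i (x i)) \<partial>PiM {1..2*p} (\<lambda>_. lborel))
                   = (\<Prod>i\<in>{1..2*p}. integral\<^sup>L lborel (f i))"
    by (rule product_integral_prod) (use f in \<open>auto simp: has_bochner_integral_iff\<close>)
  ultimately have "has_bochner_integral (PiM {1..2*p} (\<lambda>_. lborel)) (\<lambda>x. \<Prod>i\<in>{1..2*p}. f i (x i))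
                     (\<Prod>i\<in>{1..2*p}. c i)"
    using f by (simp add: has_bochner_integral_iff)
  thus ?thesis unfolding prod_odd_even by (simp add: f_def c_def)
qed

text \<open>A term of the expanded integrand: a permutation is chosen in each of the two determinants, and a
power in each geometric series, \<open>m\<close> for the entries selected by \<open>\<sigma>\<close> and \<open>m'\<close> for those selected by \<open>\<tau>\<close>.\<close>

definition monomial_term ::
    "real \<Rightarrow> nat \<Rightarrow> (nat \<Rightarrow> nat) \<Rightarrow> (nat \<Rightarrow> nat) \<Rightarrow> (nat \<Rightarrow> nat) \<Rightarrow> (nat \<Rightarrow> nat) \<Rightarrow> (nat \<Rightarrow> real) \<Rightarrow> real"
  where "monomial_term t p \<sigma> \<tau> m' m x =
     (\<Prod>j<p. odd_weight t (x (2 * j + 1))) * (\<Prod>j<p. even_weight t (x (2 * j + 2)))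
     * (\<Prod>j<p. (t * x (2 * j + 1) * x (2 * \<sigma> j + 2)) ^ m j)
     * (\<Prod>j<p. (t * x (2 * j + 1) * x (2 * \<tau> j + 2)) ^ m' j)"

lemma prod_permute_exponents:
  fixes z :: "nat \<Rightarrow> 'a :: comm_monoid_mult"
  assumes "\<sigma> permutes {..<p}"
  shows "(\<Prod>j<p. z (\<sigma> j) ^ m j) = (\<Prod>j<p. z j ^ m (Hilbert_Choice.inv \<sigma> j))"
  using prod.permute[OF assms, of "\<lambda>k. z k ^ m (Hilbert_Choice.inv \<sigma> k)"] permutes_inverses(2)[OF assms]
  by (simp add: o_def)

text \<open>The variable \<open>x (2 * k + 2)\<close> occurs with exponent \<open>m (\<sigma>\<inverse> k) + m' (\<tau>\<inverse> k)\<close>, where the superscript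
denotes the inverse permutation. Substituting \<open>k = \<sigma> j\<close> leaves \<open>m\<close> with the index \<open>j\<close> only, so
that the sum over \<open>m\<close> factors.\<close>

lemma monomial_term_integral:
  assumes t: "0 \<le> t" "t < 1" and \<sigma>: "\<sigma> permutes {..<p}" and \<tau>: "\<tau> permutes {..<p}"
  shows "has_bochner_integral (PiM {1..2*p} (\<lambda>_. lborel)) (monomial_term t p \<sigma> \<tau> m' m)
     (\<Prod>j<p. t ^ m' j * (t ^ m j * (invsqrt_moment t (real (m' j + m j))
                 * sqrt_moment t (real (m' (Hilbert_Choice.inv \<tau> (\<sigma> j)) + m j)))))"
proof -
  let ?k = "\<lambda>j. m' j + m j" and ?l = "\<lambda>j. m' (Hilbert_Choice.inv \<tau> j) + m (Hilbert_Choice.inv \<sigma> j)"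
  define C where "C = (\<Prod>j<p. t ^ m' j * t ^ m j)"
  have eq: "monomial_term t p \<sigma> \<tau> m' m x =
      C * ((\<Prod>j<p. odd_weight t (x (2 * j + 1)) * x (2 * j + 1) ^ ?k j)
          * (\<Prod>j<p. even_weight t (x (2 * j + 2)) * x (2 * j + 2) ^ ?l j))" for x
  proof -
    note perm = prod_permute_exponents[OF \<sigma>, of "\<lambda>j. x (2 * j + 2)" m]
      prod_permute_exponents[OF \<tau>, of "\<lambda>j. x (2 * j + 2)" m']
    have "monomial_term t p \<sigma> \<tau> m' m x =
       (\<Prod>j<p. odd_weight t (x (2 * j + 1))) * (\<Prod>j<p. even_weight t (x (2 * j + 2)))
       * ((\<Prod>j<p. t ^ m j) * (\<Prod>j<p. x (2 * j + 1) ^ m j) * (\<Prod>j<p. x (2 * \<sigma> j + 2) ^ m j))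
       * ((\<Prod>j<p. t ^ m' j) * (\<Prod>j<p. x (2 * j + 1) ^ m' j) * (\<Prod>j<p. x (2 * \<tau> j + 2) ^ m' j))"
      by (simp only: monomial_term_def power_mult_distrib prod.distrib)
    thus ?thesis
      unfolding perm C_def by (simp only: power_add prod.distrib mult_ac)
  qed
  have perm: "(\<Prod>j<p. sqrt_moment t (real (?l j))) =
              (\<Prod>j<p. sqrt_moment t (real (m' (Hilbert_Choice.inv \<tau> (\<sigma> j)) + m j)))"
    using prod.permute[OF \<sigma>, of "\<lambda>j. sqrt_moment t (real (?l j))"] permutes_inverses(2)[OF \<sigma>]
    by (simp add: o_def)
  have "has_bochner_integral (PiM {1..2*p} (\<lambda>_. lborel)) (monomial_term t p \<sigma> \<tau> m' m)
     (C * ((\<Prod>j<p. invsqrt_moment t (real (?k j))) * (\<Prod>j<p. sqrt_moment t (real (?l j)))))"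
    unfolding eq[abs_def] by (intro has_bochner_integral_mult_right monomial_integral t)
  thus ?thesis unfolding perm C_def by (simp only: prod.distrib mult_ac)
qed

lemma moment_kernel_nonneg:
  assumes "0 \<le> t" "t < 1" "i > - 1 / 2" "j > - 3 / 2"
  shows "0 \<le> moment_kernel t i j"
  by (rule sums_le[OF _ sums_zero moment_kernel_sums[OF assms]])
     (use assms invsqrt_moment_nonneg[of t] sqrt_moment_nonneg[of t] in auto)

lemma moment_kernel_le:
  assumes "0 \<le> t" "t < 1"
  shows "moment_kernel t (real i) (real j) \<le> moment_kernel t 0 0"
proof (rule sums_le)
  show "(\<lambda>l. t ^ l * (invsqrt_moment t (real j + real l) * sqrt_moment t (real i + real l)))
           sums moment_kernel t (real i) (real j)"
    "(\<lambda>l. t ^ l * (invsqrt_moment t (0 + real l) * sqrt_moment t (0 + real l)))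
           sums moment_kernel t 0 0"
    by (rule moment_kernel_sums; use assms in simp)+
  show "t ^ l * (invsqrt_moment t (real j + real l) * sqrt_moment t (real i + real l))
         \<le> t ^ l * (invsqrt_moment t (0 + real l) * sqrt_moment t (0 + real l))" for l
    by (intro mult_left_mono mult_mono invsqrt_moment_antimono sqrt_moment_antimono
        invsqrt_moment_nonneg sqrt_moment_nonneg) (use assms in auto)
qed

lemma permuted_moment_kernel_summable:
  fixes n p :: nat
  assumes t: "0 < t" "t < 1"
  shows "(\<lambda>m'. \<Prod>j<p. t ^ m' j * moment_kernel t (real (m' (\<rho> j))) (real (m' j)))
           summable_on (PiE {..<p} (\<lambda>_. {n..}))"
proof (rule summable_on_comparison_test)
  let ?C = "moment_kernel t 0 0"
  have "((\<lambda>m. t ^ m * ?C) has_sum (t ^ n / (1 - t) * ?C)) {n..}"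
    by (rule has_sum_cmult_left[OF geometric_has_sum]) (use t in auto)
  hence "((\<lambda>m. \<Prod>j<p. t ^ m j * ?C) has_sum (\<Prod>j<p. t ^ n / (1 - t) * ?C)) (PiE {..<p} (\<lambda>_. {n..}))"
    by (intro has_sum_prod_PiE_nonneg) (use t moment_kernel_nonneg[of t 0 0] in auto)
  thus "(\<lambda>m. \<Prod>j<p. t ^ m j * ?C) summable_on (PiE {..<p} (\<lambda>_. {n..}))"
    by (rule has_sum_imp_summable)
next
  let ?C = "moment_kernel t 0 0"
  have nonneg: "0 \<le> moment_kernel t (real i) (real j)" for i j :: nat
    by (rule moment_kernel_nonneg) (use t in auto)
  fix m' :: "nat \<Rightarrow> nat"
  show "0 \<le> (\<Prod>j<p. t ^ m' j * moment_kernel t (real (m' (\<rho> j))) (real (m' j)))"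
    using t by (intro prod_nonneg ballI mult_nonneg_nonneg nonneg) auto
  show "(\<Prod>j<p. t ^ m' j * moment_kernel t (real (m' (\<rho> j))) (real (m' j)))
          \<le> (\<Prod>j<p. t ^ m' j * ?C)"
  proof (rule prod_mono)
    fix j
    have "moment_kernel t (real (m' (\<rho> j))) (real (m' j)) \<le> ?C"
      by (rule moment_kernel_le) (use t in auto)
    thus "0 \<le> t ^ m' j * moment_kernel t (real (m' (\<rho> j))) (real (m' j)) \<and>
          t ^ m' j * moment_kernel t (real (m' (\<rho> j))) (real (m' j)) \<le> t ^ m' j * ?C"
      using t nonneg by (intro conjI mult_left_mono mult_nonneg_nonneg) auto
  qed
qed

lemma weight_product_zero:
  fixes x :: "nat \<Rightarrow> real"
  assumes "\<not> (\<forall>i\<in>{1..2*p}. x i \<in> {0<..<1})"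
  shows "(\<Prod>j<p. odd_weight t (x (2 * j + 1))) * (\<Prod>j<p. even_weight t (x (2 * j + 2))) = 0"
proof -
  define f where "f i = (if odd i then odd_weight t (x i) else even_weight t (x i))" for i :: nat
  obtain i where i: "i \<in> {1..2*p}" "x i \<notin> {0<..<1}"
    using assms by blast
  hence "f i = 0"
    by (simp add: f_def odd_weight_def even_weight_def)
  with i(1) have "(\<Prod>i=1..2*p. f i) = 0"
    by (intro prod_zero) auto
  thus ?thesis unfolding prod_odd_even by (simp add: f_def)
qed

text \<open>The contribution of one pair of permutations to the integral. The series in \<open>m'\<close> starts at \<open>n\<close>
because the factor \<open>(t * x (2 * j + 1) * x (2 * k + 2)) ^ n\<close> accompanies the second determinant.
Outside the cube everything vanishes, which is where the geometric series need not
converge.\<close>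

lemma permutation_pair_integral:
  fixes n p :: nat
  assumes t: "0 < t" "t < 1" and \<sigma>: "\<sigma> permutes {..<p}" and \<tau>: "\<tau> permutes {..<p}"
  shows "has_bochner_integral (PiM {1..2*p} (\<lambda>_. lborel))
     (\<lambda>x. (\<Prod>j<p. odd_weight t (x (2 * j + 1))) * (\<Prod>j<p. even_weight t (x (2 * j + 2)))
          * (\<Prod>j<p. 1 / (1 - t * x (2 * j + 1) * x (2 * \<sigma> j + 2)))
          * (\<Prod>j<p. (t * x (2 * j + 1) * x (2 * \<tau> j + 2)) ^ n
                     / (1 - t * x (2 * j + 1) * x (2 * \<tau> j + 2))))
     (\<Sum>\<^sub>\<infinity>m'\<in>PiE {..<p} (\<lambda>_. {n..}).
        \<Prod>j<p. t ^ m' j * moment_kernel t (real (m' (Hilbert_Choice.inv \<tau> (\<sigma> j)))) (real (m' j)))"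
    (is "has_bochner_integral _ ?g ?S")
proof -
  let ?I' = "PiE {..<p} (\<lambda>_. {n..})" and ?I = "PiE {..<p} (\<lambda>_. UNIV :: nat set)"
  let ?M = "PiM {1..2*p} (\<lambda>_. lborel :: real measure)"
  have t': "0 \<le> t" "t < 1" using t by auto
  define f where "f = (\<lambda>(m', m). monomial_term t p \<sigma> \<tau> m' m)"
  define c where "c = (\<lambda>(m', m). \<Prod>j<p. t ^ m' j * (t ^ m j * (invsqrt_moment t (real (m' j + m j))
                 * sqrt_moment t (real (m' (Hilbert_Choice.inv \<tau> (\<sigma> j)) + m j)))))"
  have f: "has_bochner_integral ?M (f mm) (c mm)" for mm
    using monomial_term_integral[OF t' \<sigma> \<tau>] by (cases mm) (simp add: f_def c_def)
  have sum_c: "(c has_sum ?S) (?I' \<times> ?I)"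
  proof (rule has_sum_SigmaI)
    have inner: "((\<lambda>m. c (m', m)) has_sum
            (\<Prod>j<p. t ^ m' j * moment_kernel t (real (m' (Hilbert_Choice.inv \<tau> (\<sigma> j)))) (real (m' j)))) ?I" for m'
      unfolding c_def prod.case
    proof (rule has_sum_prod_PiE_nonneg)
      fix j
      have "(\<lambda>l. t ^ l * (invsqrt_moment t (real (m' j) + real l)
                 * sqrt_moment t (real (m' (Hilbert_Choice.inv \<tau> (\<sigma> j))) + real l)))
             sums moment_kernel t (real (m' (Hilbert_Choice.inv \<tau> (\<sigma> j)))) (real (m' j))"
        by (rule moment_kernel_sums) (use t in auto)
      hence "((\<lambda>l. t ^ l * (invsqrt_moment t (real (m' j) + real l)
                 * sqrt_moment t (real (m' (Hilbert_Choice.inv \<tau> (\<sigma> j))) + real l)))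
             has_sum moment_kernel t (real (m' (Hilbert_Choice.inv \<tau> (\<sigma> j)))) (real (m' j))) UNIV"
        by (rule sums_nonneg_imp_has_sum)
           (use t' invsqrt_moment_nonneg[of t] sqrt_moment_nonneg[of t] in auto)
      thus "((\<lambda>l. t ^ m' j * (t ^ l * (invsqrt_moment t (real (m' j + l))
                 * sqrt_moment t (real (m' (Hilbert_Choice.inv \<tau> (\<sigma> j)) + l)))))
             has_sum (t ^ m' j * moment_kernel t (real (m' (Hilbert_Choice.inv \<tau> (\<sigma> j)))) (real (m' j)))) UNIV"
        unfolding of_nat_add by (rule has_sum_cmult_right)
    qed (use t' invsqrt_moment_nonneg[of t] sqrt_moment_nonneg[of t] in auto)
    show "((\<lambda>m. c (m', m)) has_sum
            (\<Prod>j<p. t ^ m' j * moment_kernel t (real (m' (Hilbert_Choice.inv \<tau> (\<sigma> j)))) (real (m' j)))) ?I" for m'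
      by (rule inner)
    have s: "(\<lambda>m'. \<Prod>j<p. t ^ m' j * moment_kernel t (real (m' (Hilbert_Choice.inv \<tau> (\<sigma> j)))) (real (m' j))) summable_on ?I'"
      by (rule permuted_moment_kernel_summable[OF t])
    thus "((\<lambda>m'. \<Prod>j<p. t ^ m' j * moment_kernel t (real (m' (Hilbert_Choice.inv \<tau> (\<sigma> j)))) (real (m' j)))
            has_sum ?S) ?I'"
      by (rule has_sum_infsum)
    show "c summable_on (?I' \<times> ?I)"
      by (rule summable_on_SigmaI[OF inner s])
         (use t' invsqrt_moment_nonneg[of t] sqrt_moment_nonneg[of t] in
           \<open>auto simp: c_def intro!: prod_nonneg\<close>)
  qed
  have nonneg: "0 \<le> f mm x" for mm x
  proof (cases "\<forall>i\<in>{1..2*p}. x i \<in> {0<..<1}")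
    case True
    have "0 \<le> x (2 * j + 1)" "0 \<le> x (2 * j + 2)" if "j < p" for j
      using bspec[OF True, of "2 * j + 1"] bspec[OF True, of "2 * j + 2"] that by auto
    moreover have "\<sigma> j < p" "\<tau> j < p" if "j < p" for j
      using permutes_in_image[OF \<sigma>, of j] permutes_in_image[OF \<tau>, of j] that by auto
    ultimately show ?thesis
      using t' odd_weight_nonneg[OF t'] even_weight_nonneg[OF t']
      by (cases mm) (auto simp: f_def monomial_term_def intro!: prod_nonneg mult_nonneg_nonneg)
  next
    case False
    hence "(\<Prod>j<p. odd_weight t (x (2 * j + 1))) * (\<Prod>j<p. even_weight t (x (2 * j + 2))) = 0"
      by (rule weight_product_zero)
    thus ?thesis by (cases mm) (simp only: f_def monomial_term_def prod.case mult_zero_left order_refl)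
  qed
  have lim: "((\<lambda>mm. f mm x) has_sum ?g x) (?I' \<times> ?I)" for x
  proof (cases "\<forall>i\<in>{1..2*p}. x i \<in> {0<..<1}")
    case True
    define W where "W = (\<Prod>j<p. odd_weight t (x (2 * j + 1))) * (\<Prod>j<p. even_weight t (x (2 * j + 2)))"
    define q where "q \<pi> j = t * x (2 * j + 1) * x (2 * \<pi> j + 2)" for \<pi> j
    have q: "0 \<le> q \<pi> j" "q \<pi> j < 1" if "\<pi> permutes {..<p}" "j < p" for \<pi> j
    proof -
      have "\<pi> j < p" using permutes_in_image[OF that(1), of j] that by auto
      hence x: "0 < x (2 * j + 1)" "x (2 * j + 1) < 1" "0 < x (2 * \<pi> j + 2)" "x (2 * \<pi> j + 2) < 1"
        using bspec[OF True, of "2 * j + 1"] bspec[OF True, of "2 * \<pi> j + 2"] that by auto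
      thus "0 \<le> q \<pi> j" using t by (simp add: q_def)
      have "t * x (2 * j + 1) \<le> 1" using t x by (intro mult_le_one) auto
      hence "q \<pi> j \<le> 1 * x (2 * \<pi> j + 2)"
        unfolding q_def using x by (intro mult_right_mono) auto
      thus "q \<pi> j < 1" using x by simp
    qed
    have geo: "((\<lambda>m. \<Prod>j<p. q \<pi> j ^ m j) has_sum (\<Prod>j<p. q \<pi> j ^ k / (1 - q \<pi> j)))
                 (PiE {..<p} (\<lambda>_. {k..}))" if "\<pi> permutes {..<p}" for \<pi> k
      by (rule has_sum_prod_PiE_nonneg) (use q[OF that] in \<open>auto intro!: geometric_has_sum\<close>)
    have geo0: "((\<lambda>m. \<Prod>j<p. q \<sigma> j ^ m j) has_sum (\<Prod>j<p. 1 / (1 - q \<sigma> j))) ?I"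
      using geo[OF \<sigma>, of 0] by simp
    have W: "0 \<le> W"
      unfolding W_def using odd_weight_nonneg[OF t'] even_weight_nonneg[OF t']
      by (intro mult_nonneg_nonneg prod_nonneg) auto
    have inner: "((\<lambda>m. f (m', m) x) has_sum (W * (\<Prod>j<p. 1 / (1 - q \<sigma> j)) * (\<Prod>j<p. q \<tau> j ^ m' j))) ?I" for m'
      using has_sum_cmult_left[OF has_sum_cmult_right[OF geo0, of W], of "\<Prod>j<p. q \<tau> j ^ m' j"]
      by (simp add: f_def monomial_term_def W_def q_def)
    have outer: "((\<lambda>m'. W * (\<Prod>j<p. 1 / (1 - q \<sigma> j)) * (\<Prod>j<p. q \<tau> j ^ m' j)) has_sum
             (W * (\<Prod>j<p. 1 / (1 - q \<sigma> j)) * (\<Prod>j<p. q \<tau> j ^ n / (1 - q \<tau> j)))) ?I'"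
      by (intro has_sum_cmult_right geo \<tau>)
    have "((\<lambda>mm. f mm x) has_sum
             (W * (\<Prod>j<p. 1 / (1 - q \<sigma> j)) * (\<Prod>j<p. q \<tau> j ^ n / (1 - q \<tau> j)))) (?I' \<times> ?I)"
    proof (rule has_sum_SigmaI[OF inner outer])
      show "(\<lambda>mm. f mm x) summable_on (?I' \<times> ?I)"
        by (rule summable_on_SigmaI[OF inner has_sum_imp_summable[OF outer]]) (rule nonneg)
    qed
    thus ?thesis by (simp add: W_def q_def)
  next
    case False
    hence "(\<Prod>j<p. odd_weight t (x (2 * j + 1))) * (\<Prod>j<p. even_weight t (x (2 * j + 2))) = 0"
      by (rule weight_product_zero)
    thus ?thesis
      by (simp only: f_def monomial_term_def case_prod_beta mult_zero_left has_sum_0_simp)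
  qed
  show ?thesis
  proof (rule has_bochner_integral_has_sum_nonneg)
    show "countable (?I' \<times> ?I)"
      by (intro countable_SIGMA countable_PiE) auto
    show "((\<lambda>mm. integral\<^sup>L ?M (f mm)) has_sum ?S) (?I' \<times> ?I)"
      using sum_c f by (simp add: has_bochner_integral_iff)
  qed (use f nonneg lim in \<open>auto simp: has_bochner_integral_iff\<close>)
qed

section \<open>The integrand as a product of two determinants\<close>

lemma power_prod_triangle:
  fixes t :: "'a :: comm_semiring_1"
  shows "t ^ p * (\<Prod>j<p. t ^ j)\<^sup>2 = t ^ (p * p)"
proof (induction p)
  case (Suc p)
  have "t ^ Suc p * (\<Prod>j<Suc p. t ^ j)\<^sup>2 = t ^ p * (\<Prod>j<p. t ^ j)\<^sup>2 * t ^ (2 * p + 1)"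
    by (simp add: power_mult_distrib power_add power2_eq_square power_mult mult_ac)
  also have "\<dots> = t ^ (p * p + (2 * p + 1))"
    unfolding Suc.IH by (rule power_add[symmetric])
  also have "p * p + (2 * p + 1) = Suc p * Suc p" by simp
  finally show ?case .
qed simp

text \<open>Cauchy's formula is used with \<open>a j = t * y j\<close> and \<open>b k = z k\<close>. Each of the two determinants
contributes a factor \<open>(\<Prod>j<p. t ^ j)\<close> from the differences \<open>t * y i - t * y j\<close>, and
\<open>power_prod_triangle\<close> matches these with the power of \<open>t\<close> in front of the integral.\<close>

lemma integrand_as_determinants:
  assumes t: "0 < t" "t < 1" and x: "\<And>i. i \<in> {1..2*p} \<Longrightarrow> x i \<in> {0<..<1}"
  shows "t ^ (p * (n + p)) * form_factor_integrand t n p x =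
     t ^ p * ((\<Prod>j<p. odd_weight t (x (2 * j + 1))) * (\<Prod>j<p. even_weight t (x (2 * j + 2)))
       * Determinant.det (mat p p (\<lambda>(j, k). 1 / (1 - t * x (2 * j + 1) * x (2 * k + 2))))
       * Determinant.det (mat p p (\<lambda>(j, k). (t * x (2 * j + 1) * x (2 * k + 2)) ^ n
                                                / (1 - t * x (2 * j + 1) * x (2 * k + 2)))))"
proof -
  define y z where "y j = x (2 * j + 1)" and "z j = x (2 * j + 2)" for j
  have y: "0 < y j" "y j < 1" and z: "0 < z j" "z j < 1" if "j < p" for j
    using x[of "2 * j + 1"] x[of "2 * j + 2"] that by (auto simp: y_def z_def)
  define W where "W = (\<Prod>j<p. odd_weight t (y j)) * (\<Prod>j<p. even_weight t (z j))"
  define V where "V = (\<Prod>j<p. \<Prod>i<j. (y i - y j) * (z i - z j))"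
  define C where "C = (\<Prod>i<p. \<Prod>j<p. (1 - t * y i * z j))"
  define T where "T = (\<Prod>j<p. t ^ j)"
  define Y Z where "Y = (\<Prod>j<p. y j ^ n)" and "Z = (\<Prod>j<p. z j ^ n)"
  have lt1: "t * y i * z j < 1" if "i < p" "j < p" for i j
  proof -
    have "t * y i * z j \<le> 1 * z j"
      using t y[OF that(1)] z[OF that(2)] by (intro mult_right_mono mult_le_one) auto
    thus ?thesis by (rule le_less_trans) (use z[OF that(2)] in simp)
  qed
  have det1: "Determinant.det (mat p p (\<lambda>(j, k). 1 / (1 - t * y j * z k))) = T * V / C"
  proof -
    have "Determinant.det (mat p p (\<lambda>(j, k). 1 / (1 - t * y j * z k))) =
          (\<Prod>j<p. \<Prod>i<j. (t * y i - t * y j) * (z i - z j)) / C"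
      unfolding C_def by (rule cauchy_det) (use lt1 in \<open>auto simp: less_imp_neq\<close>)
    also have "(\<Prod>j<p. \<Prod>i<j. (t * y i - t * y j) * (z i - z j)) =
               (\<Prod>j<p. t ^ j * (\<Prod>i<j. (y i - y j) * (z i - z j)))"
    proof (rule prod.cong[OF refl])
      fix j
      have "(\<Prod>i<j. (t * y i - t * y j) * (z i - z j)) = (\<Prod>i<j. t * ((y i - y j) * (z i - z j)))"
        by (simp add: algebra_simps)
      thus "(\<Prod>i<j. (t * y i - t * y j) * (z i - z j)) = t ^ j * (\<Prod>i<j. (y i - y j) * (z i - z j))"
        by (simp add: prod.distrib)
    qed
    finally show ?thesis by (simp add: prod.distrib T_def V_def)
  qed
  \<comment> \<open>The \<open>n\<close>-th powers split into a row factor and a column factor.\<close>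
  have det2: "Determinant.det (mat p p (\<lambda>(j, k). (t * y j * z k) ^ n / (1 - t * y j * z k)))
              = t ^ (p * n) * Y * Z * (T * V / C)"
  proof -
    have "Determinant.det (mat p p (\<lambda>(j, k). (t * y j * z k) ^ n / (1 - t * y j * z k))) =
          Determinant.det (mat p p (\<lambda>(j, k). (t ^ n * y j ^ n) * z k ^ n * (1 / (1 - t * y j * z k))))"
      by (simp add: power_mult_distrib)
    also have "\<dots> = (\<Prod>j<p. t ^ n * y j ^ n) * (\<Prod>k<p. z k ^ n) * (T * V / C)"
      unfolding det_row_col_scale det1 ..
    also have "(\<Prod>j<p. t ^ n * y j ^ n) = t ^ (p * n) * Y"
      by (simp add: prod.distrib Y_def power_mult[symmetric] mult.commute)
    finally show ?thesis by (simp add: Z_def)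
  qed
  have F1: "(\<Prod>i=1..2*p. x i ^ n) = Y * Z"
    unfolding prod_odd_even Y_def Z_def y_def z_def ..
  have F2: "(\<Prod>j=1..p. sqrt (((1 - t * x (2*j)) * (inverse (x (2*j)) - 1))
                     / ((1 - t * x (2*j-1)) * (inverse (x (2*j-1)) - 1)))) = W"
  proof -
    have "(\<Prod>j=1..p. sqrt (((1 - t * x (2*j)) * (inverse (x (2*j)) - 1))
                     / ((1 - t * x (2*j-1)) * (inverse (x (2*j-1)) - 1)))) =
          (\<Prod>j<p. sqrt (((1 - t * z j) * (inverse (z j) - 1)) / ((1 - t * y j) * (inverse (y j) - 1))))"
      by (simp add: prod.atLeast1_atMost_eq y_def z_def)
    also have "\<dots> = (\<Prod>j<p. odd_weight t (y j) * even_weight t (z j))"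
    proof (rule prod.cong[OF refl])
      fix j assume "j \<in> {..<p}"
      hence "y j \<in> {0<..<1}" "z j \<in> {0<..<1}" using y[of j] z[of j] by auto
      thus "sqrt (((1 - t * z j) * (inverse (z j) - 1)) / ((1 - t * y j) * (inverse (y j) - 1))) =
            odd_weight t (y j) * even_weight t (z j)"
        unfolding real_sqrt_divide odd_weight_def even_weight_def by (simp only: indicator_simps) simp
    qed
    finally show ?thesis by (simp add: prod.distrib W_def)
  qed
  have F3: "(\<Prod>j=1..p. \<Prod>l=1..p. (1 - t * x (2*l-1) * x (2*j)) powi (- 2)) = inverse (C\<^sup>2)"
  proof -
    have "(\<Prod>j=1..p. \<Prod>l=1..p. (1 - t * x (2*l-1) * x (2*j)) powi (- 2)) =
          (\<Prod>j<p. \<Prod>l<p. inverse ((1 - t * y l * z j)\<^sup>2))"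
      by (simp add: prod.atLeast1_atMost_eq y_def z_def power_int_minus)
    also have "\<dots> = (\<Prod>l<p. \<Prod>j<p. inverse ((1 - t * y l * z j)\<^sup>2))"
      by (rule prod.swap)
    also have "\<dots> = inverse (C\<^sup>2)"
      by (simp only: C_def prod_inversef[unfolded o_def] prod_power_distrib)
    finally show ?thesis .
  qed
  have F4: "(\<Prod>(j, l) \<in> {(j, l). 1 \<le> j \<and> j < l \<and> l \<le> p}.
          (x (2*j-1) - x (2*l-1))\<^sup>2 * (x (2*j) - x (2*l))\<^sup>2) = V\<^sup>2"
  proof -
    let ?S = "Sigma {..<p} (\<lambda>l. {..<l})"
    have bij: "bij_betw (\<lambda>(l, i). (Suc i, Suc l)) ?S {(j, l). 1 \<le> j \<and> j < l \<and> l \<le> p}"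
      by (rule bij_betwI[of _ _ _ "\<lambda>(j, l). (l - 1, j - 1)"]) auto
    have "(\<Prod>(j, l) \<in> {(j, l). 1 \<le> j \<and> j < l \<and> l \<le> p}.
          (x (2*j-1) - x (2*l-1))\<^sup>2 * (x (2*j) - x (2*l))\<^sup>2) =
          (\<Prod>(l, i)\<in>?S. ((y i - y l) * (z i - z l))\<^sup>2)"
      by (subst prod.reindex_bij_betw[OF bij, symmetric])
         (auto intro!: prod.cong simp: y_def z_def power_mult_distrib)
    also have "\<dots> = (\<Prod>l<p. \<Prod>i<l. ((y i - y l) * (z i - z l))\<^sup>2)"
      by (subst prod.Sigma) auto
    also have "\<dots> = V\<^sup>2"
      by (simp only: V_def prod_power_distrib)
    finally show ?thesis .
  qed
  have "t ^ (p * (n + p)) * form_factor_integrand t n p x =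
        t ^ (p * n) * t ^ (p * p) * (Y * Z * W * inverse (C\<^sup>2) * V\<^sup>2)"
    unfolding form_factor_integrand_def F1 F2 F3 F4 by (simp add: power_add distrib_left)
  also have "\<dots> = t ^ (p * n) * (t ^ p * T\<^sup>2) * (Y * Z * W * inverse (C\<^sup>2) * V\<^sup>2)"
    unfolding T_def power_prod_triangle ..
  also have "\<dots> = t ^ p * (W
       * Determinant.det (mat p p (\<lambda>(j, k). 1 / (1 - t * y j * z k)))
       * Determinant.det (mat p p (\<lambda>(j, k). (t * y j * z k) ^ n / (1 - t * y j * z k))))"
    unfolding det1 det2 by (simp add: power2_eq_square divide_inverse mult_ac)
  finally show ?thesis
    unfolding W_def y_def z_def .
qed

section \<open>Summation over tuples\<close>

text \<open>For fixed \<open>\<tau>\<close> the substitution \<open>\<sigma> = \<tau> \<circ> \<rho>\<close> removes \<open>\<tau>\<close> from the summand.\<close>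

lemma sum_signed_permutation_pairs:
  fixes S :: "(nat \<Rightarrow> nat) \<Rightarrow> real"
  shows "(\<Sum>\<sigma> | \<sigma> permutes {0..<p}. \<Sum>\<tau> | \<tau> permutes {0..<p}.
            signof \<sigma> * signof \<tau> * S (\<lambda>j. Hilbert_Choice.inv \<tau> (\<sigma> j))) =
         fact p * (\<Sum>\<rho> | \<rho> permutes {0..<p}. signof \<rho> * S \<rho>)"
proof -
  let ?P = "{\<sigma>. \<sigma> permutes {0..<p}}"
  have inner: "(\<Sum>\<sigma>\<in>?P. signof \<sigma> * signof \<tau> * S (\<lambda>j. Hilbert_Choice.inv \<tau> (\<sigma> j))) =
               (\<Sum>\<rho>\<in>?P. signof \<rho> * S \<rho>)" if \<tau>: "\<tau> permutes {0..<p}" for \<tau>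
  proof -
    have "(\<Sum>\<sigma>\<in>?P. signof \<sigma> * signof \<tau> * S (\<lambda>j. Hilbert_Choice.inv \<tau> (\<sigma> j))) =
          (\<Sum>\<rho>\<in>?P. signof (\<tau> \<circ> \<rho>) * signof \<tau> * S (\<lambda>j. Hilbert_Choice.inv \<tau> ((\<tau> \<circ> \<rho>) j)))"
      by (rule setum_permutations_compose_left[OF \<tau>])
    also have "\<dots> = (\<Sum>\<rho>\<in>?P. signof \<rho> * S \<rho>)"
    proof (rule sum.cong[OF refl])
      fix \<rho> assume "\<rho> \<in> ?P"
      hence perm: "permutation \<tau>" "permutation \<rho>"
        using \<tau> by (auto intro: permutes_imp_permutation[of "{0..<p}"])
      have "sign (\<tau> \<circ> \<rho>) * sign \<tau> = sign \<rho>"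
        unfolding sign_compose[OF perm] by (simp add: mult_ac)
      hence "signof (\<tau> \<circ> \<rho>) * signof \<tau> = (signof \<rho> :: real)"
        by (simp only: of_int_mult[symmetric])
      thus "signof (\<tau> \<circ> \<rho>) * signof \<tau> * S (\<lambda>j. Hilbert_Choice.inv \<tau> ((\<tau> \<circ> \<rho>) j)) = signof \<rho> * S \<rho>"
        using permutes_inverses(2)[OF \<tau>] by simp
    qed
    finally show ?thesis .
  qed
  have "(\<Sum>\<sigma>\<in>?P. \<Sum>\<tau>\<in>?P. signof \<sigma> * signof \<tau> * S (\<lambda>j. Hilbert_Choice.inv \<tau> (\<sigma> j))) =
        (\<Sum>\<tau>\<in>?P. \<Sum>\<sigma>\<in>?P. signof \<sigma> * signof \<tau> * S (\<lambda>j. Hilbert_Choice.inv \<tau> (\<sigma> j)))"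
    by (rule sum.swap)
  also have "\<dots> = (\<Sum>\<tau>\<in>?P. \<Sum>\<rho>\<in>?P. signof \<rho> * S \<rho>)"
    by (intro sum.cong refl inner) auto
  also have "\<dots> = fact p * (\<Sum>\<rho>\<in>?P. signof \<rho> * S \<rho>)"
    by (simp add: card_permutations[OF refl])
  finally show ?thesis .
qed

text \<open>The summand that belongs to the tuple \<open>m 0, \<dots>, m (p - 1)\<close>. In the Leibniz expansion the
permutation acts on the first argument of \<open>moment_kernel\<close>, as in \<open>permutation_pair_integral\<close>;
relative to the matrix of kernel values this is the transpose.\<close>

definition moment_det :: "real \<Rightarrow> nat \<Rightarrow> (nat \<Rightarrow> nat) \<Rightarrow> real" where
  "moment_det t p m =
     Determinant.det (mat p p (\<lambda>(j, k). t ^ m j * moment_kernel t (real (m k)) (real (m j))))"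

lemma cube_integral_eq_moment_det_sum:
  fixes n p :: nat
  assumes t: "0 < t" "t < 1"
  shows "moment_det t p summable_on ({0..<p} \<rightarrow>\<^sub>E {n..})"
    and "t ^ (p * (n + p)) * (LINT x : PiE {1..2*p} (\<lambda>_. {0<..<1}) | PiM {1..2*p} (\<lambda>_. lborel).
            form_factor_integrand t n p x) =
         t ^ p * (fact p * infsum (moment_det t p) ({0..<p} \<rightarrow>\<^sub>E {n..}))"
proof -
  let ?M = "PiM {1..2*p} (\<lambda>_. lborel :: real measure)"
  let ?P = "{\<sigma>. \<sigma> permutes {0..<p}}"
  let ?I = "{0..<p} \<rightarrow>\<^sub>E {n..}"
  define h where "h \<rho> m = (\<Prod>j = 0..<p. t ^ m j * moment_kernel t (real (m (\<rho> j))) (real (m j)))" for \<rho> m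
  define S where "S \<rho> = infsum (h \<rho>) ?I" for \<rho>
  have "h \<rho> summable_on ?I" for \<rho>
    using permuted_moment_kernel_summable[OF t, where p = p and n = n and \<rho> = \<rho>]
    by (simp add: h_def[abs_def] lessThan_atLeast0)
  hence h: "(h \<rho> has_sum S \<rho>) ?I" for \<rho>
    unfolding S_def by (rule has_sum_infsum)
  have det_h: "moment_det t p m = (\<Sum>\<rho>\<in>?P. signof \<rho> * h \<rho> m)" for m
    unfolding moment_det_def det_mat_leibniz h_def ..
  have det_sum: "(moment_det t p has_sum (\<Sum>\<rho>\<in>?P. signof \<rho> * S \<rho>)) ?I"
    unfolding det_h[abs_def] by (intro has_sum_linear_combination h) (simp add: finite_permutations)
  thus "moment_det t p summable_on ?I"
    by (rule has_sum_imp_summable)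
  define w where "w x = (\<Prod>j<p. odd_weight t (x (2 * j + 1))) * (\<Prod>j<p. even_weight t (x (2 * j + 2)))" for x
  define q where "q x j k = t * x (2 * j + 1) * x (2 * k + 2)" for x :: "nat \<Rightarrow> real" and j k
  define g where "g \<sigma> \<tau> x = w x * (\<Prod>j = 0..<p. 1 / (1 - q x j (\<sigma> j)))
                   * (\<Prod>j = 0..<p. q x j (\<tau> j) ^ n / (1 - q x j (\<tau> j)))" for \<sigma> \<tau> x
  have g: "has_bochner_integral ?M (g \<sigma> \<tau>) (S (\<lambda>j. Hilbert_Choice.inv \<tau> (\<sigma> j)))"
    if "\<sigma> \<in> ?P" "\<tau> \<in> ?P" for \<sigma> \<tau>
    using permutation_pair_integral[OF t, where p = p and n = n and \<sigma> = \<sigma> and \<tau> = \<tau>] that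
    by (simp add: g_def[abs_def] w_def q_def S_def h_def[abs_def] lessThan_atLeast0)
  have gsum: "has_bochner_integral ?M (\<lambda>x. t ^ p * (\<Sum>\<sigma>\<in>?P. \<Sum>\<tau>\<in>?P. signof \<sigma> * signof \<tau> * g \<sigma> \<tau> x))
        (t ^ p * (\<Sum>\<sigma>\<in>?P. \<Sum>\<tau>\<in>?P. signof \<sigma> * signof \<tau> * S (\<lambda>j. Hilbert_Choice.inv \<tau> (\<sigma> j))))"
    by (intro has_bochner_integral_mult_right has_bochner_integral_sum g)
  have integrand: "t ^ (p * (n + p)) * (indicator (PiE {1..2*p} (\<lambda>_. {0<..<1})) x *\<^sub>R form_factor_integrand t n p x)
        = t ^ p * (\<Sum>\<sigma>\<in>?P. \<Sum>\<tau>\<in>?P. signof \<sigma> * signof \<tau> * g \<sigma> \<tau> x)" if "x \<in> space ?M" for x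
  proof (cases "\<forall>i\<in>{1..2*p}. x i \<in> {0<..<1}")
    case True
    have "x \<in> PiE {1..2*p} (\<lambda>_. {0<..<1})"
      using True that by (auto simp: space_PiM PiE_def)
    moreover have "t ^ (p * (n + p)) * form_factor_integrand t n p x = t ^ p * (w x
       * Determinant.det (mat p p (\<lambda>(j, k). 1 / (1 - q x j k)))
       * Determinant.det (mat p p (\<lambda>(j, k). q x j k ^ n / (1 - q x j k))))"
      unfolding w_def q_def by (rule integrand_as_determinants[OF t]) (use True in auto)
    moreover have "w x
       * Determinant.det (mat p p (\<lambda>(j, k). 1 / (1 - q x j k)))
       * Determinant.det (mat p p (\<lambda>(j, k). q x j k ^ n / (1 - q x j k)))
       = (\<Sum>\<sigma>\<in>?P. \<Sum>\<tau>\<in>?P. signof \<sigma> * signof \<tau> * g \<sigma> \<tau> x)"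
      unfolding det_mat_leibniz mult.assoc sum_product
      unfolding sum_distrib_left g_def by (intro sum.cong refl) (simp only: mult_ac)
    ultimately show ?thesis by simp
  next
    case False
    have "x \<notin> PiE {1..2*p} (\<lambda>_. {0<..<1})"
      using False by (auto dest: PiE_mem)
    moreover have "w x = 0"
      unfolding w_def by (rule weight_product_zero[OF False])
    ultimately show ?thesis by (simp add: g_def)
  qed
  have "t ^ (p * (n + p)) * (LINT x : PiE {1..2*p} (\<lambda>_. {0<..<1}) | ?M. form_factor_integrand t n p x) =
        (\<integral>x. t ^ (p * (n + p)) * (indicator (PiE {1..2*p} (\<lambda>_. {0<..<1})) x *\<^sub>R form_factor_integrand t n p x) \<partial>?M)"
    unfolding set_lebesgue_integral_def by (rule integral_mult_right_zero[symmetric])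
  also have "\<dots> = (\<integral>x. t ^ p * (\<Sum>\<sigma>\<in>?P. \<Sum>\<tau>\<in>?P. signof \<sigma> * signof \<tau> * g \<sigma> \<tau> x) \<partial>?M)"
    by (intro Bochner_Integration.integral_cong refl integrand)
  also have "\<dots> = t ^ p * (fact p * (\<Sum>\<rho>\<in>?P. signof \<rho> * S \<rho>))"
    using gsum unfolding sum_signed_permutation_pairs by (rule has_bochner_integral_integral_eq)
  also have "(\<Sum>\<rho>\<in>?P. signof \<rho> * S \<rho>) = infsum (moment_det t p) ?I"
    using det_sum by (rule infsumI[symmetric])
  finally show "t ^ (p * (n + p)) * (LINT x : PiE {1..2*p} (\<lambda>_. {0<..<1}) | PiM {1..2*p} (\<lambda>_. lborel).
            form_factor_integrand t n p x) =
         t ^ p * (fact p * infsum (moment_det t p) ({0..<p} \<rightarrow>\<^sub>E {n..}))" .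
qed

section \<open>Symmetric summation over strictly decreasing tuples\<close>

lemma decreasing_tuples_distinct:
  assumes "ns \<in> decreasing_tuples n p"
  shows "distinct ns" "length ns = p" "set ns \<subseteq> {n..}"
proof -
  have "sorted_wrt (<) (rev ns)"
    using assms by (simp add: decreasing_tuples_def sorted_wrt_rev)
  thus "distinct ns" by (simp add: strict_sorted_iff)
  show "length ns = p" "set ns \<subseteq> {n..}"
    using assms by (auto simp: decreasing_tuples_def)
qed

text \<open>An injective tuple is a strictly decreasing one together with a rearrangement, in a unique way.\<close>

lemma bij_betw_decreasing_permuted:
  "bij_betw (\<lambda>(ns, \<pi>). \<lambda>i\<in>{0..<p}. ns ! \<pi> i)
     (decreasing_tuples n p \<times> {\<pi>. \<pi> permutes {0..<p}})
     {m \<in> {0..<p} \<rightarrow>\<^sub>E {n..}. inj_on m {0..<p}}"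
  unfolding bij_betw_def
proof (intro conjI inj_onI subset_antisym subsetI)
  fix x y
  assume x: "x \<in> decreasing_tuples n p \<times> {\<pi>. \<pi> permutes {0..<p}}"
    and y: "y \<in> decreasing_tuples n p \<times> {\<pi>. \<pi> permutes {0..<p}}"
    and eq: "(case x of (ns, \<pi>) \<Rightarrow> \<lambda>i\<in>{0..<p}. ns ! \<pi> i) = (case y of (ns, \<pi>) \<Rightarrow> \<lambda>i\<in>{0..<p}. ns ! \<pi> i)"
  obtain ns \<pi> ns' \<pi>' where xy: "x = (ns, \<pi>)" "y = (ns', \<pi>')" by (cases x, cases y)
  have \<pi>: "\<pi> permutes {0..<p}" "\<pi>' permutes {0..<p}" using x y xy by auto
  have ns: "ns \<in> decreasing_tuples n p" "ns' \<in> decreasing_tuples n p" using x y xy by auto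
  note d = decreasing_tuples_distinct[OF ns(1)] and d' = decreasing_tuples_distinct[OF ns(2)]
  have nth: "ns ! \<pi> i = ns' ! \<pi>' i" if "i < p" for i
    using fun_cong[OF eq, of i] that xy by simp
  have set_eq: "set ms = (\<lambda>i. ms ! \<sigma> i) ` {0..<p}"
    if "\<sigma> permutes {0..<p}" "length ms = p" for \<sigma> and ms :: "nat list"
  proof -
    have "set ms = (!) ms ` {0..<p}" using that by (auto simp: set_conv_nth)
    also have "{0..<p} = \<sigma> ` {0..<p}" using permutes_image[OF that(1)] by simp
    finally show ?thesis by (simp add: image_image)
  qed
  have "set ns = set ns'"
    using set_eq[OF \<pi>(1) d(2)] set_eq[OF \<pi>(2) d'(2)] nth by auto
  moreover have "sorted_wrt (<) (rev ns)" "sorted_wrt (<) (rev ns')"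
    using ns by (auto simp: decreasing_tuples_def sorted_wrt_rev)
  ultimately have "rev ns = rev ns'"
    by (intro strict_sorted_equal) auto
  hence nseq: "ns = ns'" by simp
  have "\<pi> i = \<pi>' i" for i
  proof (cases "i < p")
    case True
    have "\<pi> i < p" "\<pi>' i < p"
      using True permutes_in_image[OF \<pi>(1), of i] permutes_in_image[OF \<pi>(2), of i] by auto
    thus ?thesis using nth[OF True] d nseq by (simp add: nth_eq_iff_index_eq)
  next
    case False
    thus ?thesis using \<pi> by (simp add: permutes_not_in)
  qed
  thus "x = y" using xy nseq by auto
next
  fix m
  assume "m \<in> (\<lambda>(ns, \<pi>). \<lambda>i\<in>{0..<p}. ns ! \<pi> i) ` (decreasing_tuples n p \<times> {\<pi>. \<pi> permutes {0..<p}})"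
  then obtain ns \<pi> where ns: "ns \<in> decreasing_tuples n p" and \<pi>: "\<pi> permutes {0..<p}"
    and m: "m = (\<lambda>i\<in>{0..<p}. ns ! \<pi> i)" by auto
  note d = decreasing_tuples_distinct[OF ns]
  have lt: "\<pi> i < p" if "i < p" for i
    using permutes_in_image[OF \<pi>, of i] that by auto
  have "ns ! \<pi> i \<ge> n" if "i < p" for i
  proof -
    have "ns ! \<pi> i \<in> set ns" using d(2) lt[OF that] by simp
    thus ?thesis using d(3) by auto
  qed
  moreover have "inj_on (\<lambda>i. ns ! \<pi> i) {0..<p}"
    using d lt permutes_inj[OF \<pi>] by (auto simp: inj_on_def nth_eq_iff_index_eq)
  ultimately show "m \<in> {m \<in> {0..<p} \<rightarrow>\<^sub>E {n..}. inj_on m {0..<p}}"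
    by (auto simp: m inj_on_def)
next
  fix m assume m: "m \<in> {m \<in> {0..<p} \<rightarrow>\<^sub>E {n..}. inj_on m {0..<p}}"
  \<comment> \<open>Sort the values in decreasing order, and let \<open>\<pi> i\<close> be the position of the value \<open>m i\<close>.\<close>
  define ns where "ns = rev (sorted_list_of_set (m ` {0..<p}))"
  have set_ns: "set ns = m ` {0..<p}" by (simp add: ns_def)
  have len: "length ns = p" using m by (simp add: ns_def card_image)
  have dist: "distinct ns" by (simp add: ns_def)
  have "sorted_wrt (>) ns"
    unfolding ns_def sorted_wrt_rev using strict_sorted_list_of_set by auto
  hence ns: "ns \<in> decreasing_tuples n p"
    using len set_ns m by (auto simp: decreasing_tuples_def)
  have bij_ns: "bij_betw ((!) ns) {0..<p} (m ` {0..<p})"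
    using bij_betw_nth[OF dist refl refl] len set_ns by (simp add: lessThan_atLeast0)
  define \<pi> where "\<pi> i = (if i \<in> {0..<p} then inv_into {0..<p} ((!) ns) (m i) else i)" for i
  have "bij_betw (inv_into {0..<p} ((!) ns) \<circ> m) {0..<p} {0..<p}"
    using m by (intro bij_betw_trans[OF _ bij_betw_inv_into[OF bij_ns]]) (auto simp: bij_betw_def)
  hence "bij_betw \<pi> {0..<p} {0..<p}"
    by (rule bij_betw_cong[THEN iffD1, rotated]) (auto simp: \<pi>_def)
  hence "\<pi> permutes {0..<p}"
    by (rule bij_imp_permutes) (auto simp: \<pi>_def)
  moreover have "m = (\<lambda>i\<in>{0..<p}. ns ! \<pi> i)"
  proof
    fix i
    show "m i = (\<lambda>i\<in>{0..<p}. ns ! \<pi> i) i"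
    proof (cases "i \<in> {0..<p}")
      case True
      hence "m i \<in> (!) ns ` {0..<p}" using bij_ns by (auto simp: bij_betw_def)
      thus ?thesis using True by (simp add: \<pi>_def f_inv_into_f)
    next
      case False
      thus ?thesis using m by (auto simp: PiE_def extensional_def)
    qed
  qed
  ultimately show "m \<in> (\<lambda>(ns, \<pi>). \<lambda>i\<in>{0..<p}. ns ! \<pi> i) ` (decreasing_tuples n p \<times> {\<pi>. \<pi> permutes {0..<p}})"
    using ns by (intro image_eqI[of _ _ "(ns, \<pi>)"]) auto
qed

lemma infsum_symmetric_tuples:
  fixes E :: "(nat \<Rightarrow> nat) \<Rightarrow> real"
  assumes summable: "E summable_on ({0..<p} \<rightarrow>\<^sub>E {n..})"
    and sym: "\<And>m \<pi>. \<pi> permutes {0..<p} \<Longrightarrow> E (\<lambda>i\<in>{0..<p}. m (\<pi> i)) = E m"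
    and vanish: "\<And>m. \<not> inj_on m {0..<p} \<Longrightarrow> E m = 0"
  shows "(\<lambda>ns. E ((!) ns)) summable_on decreasing_tuples n p"
    and "infsum E ({0..<p} \<rightarrow>\<^sub>E {n..}) = fact p * (\<Sum>\<^sub>\<infinity>ns\<in>decreasing_tuples n p. E ((!) ns))"
proof -
  let ?P = "{\<pi>. \<pi> permutes {0..<p}}"
  let ?D = "decreasing_tuples n p"
  let ?J = "{m \<in> {0..<p} \<rightarrow>\<^sub>E {n..}. inj_on m {0..<p}}"
  have sumJ: "E summable_on ?J"
    using summable by (rule summable_on_subset) auto
  have eq: "E (case x of (ns, \<pi>) \<Rightarrow> \<lambda>i\<in>{0..<p}. ns ! \<pi> i) = (case x of (ns, \<pi>) \<Rightarrow> E ((!) ns))"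
    if "x \<in> ?D \<times> ?P" for x
    using that sym by auto
  have "(\<lambda>x. E (case x of (ns, \<pi>) \<Rightarrow> \<lambda>i\<in>{0..<p}. ns ! \<pi> i)) summable_on (?D \<times> ?P)"
    using sumJ summable_on_reindex_bij_betw[OF bij_betw_decreasing_permuted, of E p n] by simp
  hence sumDP: "(\<lambda>(ns, \<pi>). E ((!) ns)) summable_on (?D \<times> ?P)"
    by (rule summable_on_cong[THEN iffD1, rotated]) (rule eq)
  have "(\<lambda>(ns, \<pi>). E ((!) ns)) summable_on (?D \<times> {id :: nat \<Rightarrow> nat})"
    using sumDP by (rule summable_on_subset) (auto simp: permutes_id)
  moreover have "bij_betw (\<lambda>ns. (ns, id)) ?D (?D \<times> {id :: nat \<Rightarrow> nat})"
    by (auto simp: bij_betw_def inj_on_def)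
  ultimately show "(\<lambda>ns. E ((!) ns)) summable_on ?D"
    using summable_on_reindex_bij_betw[of "\<lambda>ns. (ns, id :: nat \<Rightarrow> nat)" ?D "?D \<times> {id}" "\<lambda>(ns, \<pi>). E ((!) ns)"]
    by simp
  have "infsum E ({0..<p} \<rightarrow>\<^sub>E {n..}) = infsum E ?J"
    by (rule infsum_cong_neutral) (use vanish in auto)
  also have "\<dots> = (\<Sum>\<^sub>\<infinity>x\<in>?D \<times> ?P. E (case x of (ns, \<pi>) \<Rightarrow> \<lambda>i\<in>{0..<p}. ns ! \<pi> i))"
    by (rule infsum_reindex_bij_betw[OF bij_betw_decreasing_permuted, symmetric])
  also have "\<dots> = (\<Sum>\<^sub>\<infinity>(ns, \<pi>)\<in>?D \<times> ?P. E ((!) ns))"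
    by (rule infsum_cong) (rule eq)
  also have "\<dots> = (\<Sum>\<^sub>\<infinity>ns\<in>?D. \<Sum>\<^sub>\<infinity>\<pi>\<in>?P. E ((!) ns))"
    by (rule infsum_Sigma'_banach[symmetric]) (use sumDP in simp)
  also have "\<dots> = (\<Sum>\<^sub>\<infinity>ns\<in>?D. fact p * E ((!) ns))"
    by (simp add: finite_permutations card_permutations[OF refl])
  also have "\<dots> = fact p * (\<Sum>\<^sub>\<infinity>ns\<in>?D. E ((!) ns))"
    by (simp add: infsum_cmult_right')
  finally show "infsum E ({0..<p} \<rightarrow>\<^sub>E {n..}) = fact p * (\<Sum>\<^sub>\<infinity>ns\<in>decreasing_tuples n p. E ((!) ns))" .
qed

section \<open>Determinants of the kernel\<close>

text \<open>\<open>kernel_det\<close> for a tuple given as a function on \<open>{0..<p}\<close>, in any order and possibly with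
repetitions.\<close>

definition kernel_tuple_det :: "real \<Rightarrow> nat \<Rightarrow> (nat \<Rightarrow> nat) \<Rightarrow> real" where
  "kernel_tuple_det t p m = Determinant.det (mat p p (\<lambda>(j, k). kernel t (m j) (m k)))"

lemma kernel_tuple_det_eq:
  assumes t: "0 < t" "t < 1"
  shows "kernel_tuple_det t p m = (- t / pi\<^sup>2) ^ p * moment_det t p m"
proof -
  define s where "s = sqrt t"
  have s: "0 < s" "s * s = t" using t by (auto simp: s_def)
  let ?K = "\<lambda>j k. moment_kernel t (real (m j)) (real (m k))"
  have "t powr ((real a + real b) / 2 + 1) = s ^ a * s ^ b * t" for a b
  proof -
    have "t powr (real c / 2) = s ^ c" for c
      using t by (simp add: s_def powr_half_sqrt[symmetric] powr_power)
    thus ?thesis using t by (simp add: add_divide_distrib powr_add)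
  qed
  \<comment> \<open>The power of \<open>t\<close> in the kernel splits into a row factor and a column factor.\<close>
  hence entry: "kernel t (m j) (m k) = (- t / pi\<^sup>2 * s ^ m j) * s ^ m k * ?K j k" for j k
    by (simp add: kernel_eq[OF t])
  have "kernel_tuple_det t p m =
      (\<Prod>j<p. - t / pi\<^sup>2 * s ^ m j) * (\<Prod>k<p. s ^ m k) * Determinant.det (mat p p (\<lambda>(j, k). ?K j k))"
    unfolding kernel_tuple_det_def entry by (rule det_row_col_scale)
  also have "(\<Prod>j<p. - t / pi\<^sup>2 * s ^ m j) * (\<Prod>k<p. s ^ m k) = (- t / pi\<^sup>2) ^ p * (\<Prod>j<p. t ^ m j)"
    unfolding s(2)[symmetric] power_mult_distrib prod.distrib by simp
  also have "Determinant.det (mat p p (\<lambda>(j, k). ?K j k)) = Determinant.det (mat p p (\<lambda>(j, k). ?K k j))"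
  proof -
    have "mat p p (\<lambda>(j, k). ?K k j) = transpose_mat (mat p p (\<lambda>(j, k). ?K j k))"
      by (rule eq_matI) auto
    thus ?thesis by (simp add: det_transpose[of _ p])
  qed
  also have "(- t / pi\<^sup>2) ^ p * (\<Prod>j<p. t ^ m j) * Determinant.det (mat p p (\<lambda>(j, k). ?K k j)) =
             (- t / pi\<^sup>2) ^ p * moment_det t p m"
    using det_row_col_scale[of p "\<lambda>j. t ^ m j" "\<lambda>_. 1" "\<lambda>j k. ?K k j"]
    by (simp add: moment_det_def mult.assoc)
  finally show ?thesis .
qed

lemma det_permute_rows_cols:
  fixes A :: "nat \<Rightarrow> nat \<Rightarrow> 'a :: comm_ring_1"
  assumes "\<pi> permutes {0..<p}"
  shows "Determinant.det (mat p p (\<lambda>(j, k). A (\<pi> j) (\<pi> k))) = Determinant.det (mat p p (\<lambda>(j, k). A j k))"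
proof -
  have lt: "\<pi> i < p" if "i < p" for i
    using permutes_in_image[OF assms, of i] that by auto
  have rows: "Determinant.det (mat p p (\<lambda>(j, k). B (\<pi> j) k)) = signof \<pi> * Determinant.det (mat p p (\<lambda>(j, k). B j k))"
    for B :: "nat \<Rightarrow> nat \<Rightarrow> 'a"
  proof -
    have "mat p p (\<lambda>(j, k). B (\<pi> j) k) = mat p p (\<lambda>(j, k). mat p p (\<lambda>(j, k). B j k) $$ (\<pi> j, k))"
      by (rule eq_matI) (auto simp: lt)
    thus ?thesis using det_permute_rows[OF _ assms, of "mat p p (\<lambda>(j, k). B j k)"] by simp
  qed
  have transp: "Determinant.det (mat p p (\<lambda>(j, k). B k j)) = Determinant.det (mat p p (\<lambda>(j, k). B j k))"
    for B :: "nat \<Rightarrow> nat \<Rightarrow> 'a"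
  proof -
    have "mat p p (\<lambda>(j, k). B k j) = transpose_mat (mat p p (\<lambda>(j, k). B j k))"
      by (rule eq_matI) auto
    thus ?thesis by (simp add: det_transpose[of _ p])
  qed
  have "Determinant.det (mat p p (\<lambda>(j, k). A (\<pi> j) (\<pi> k))) =
        signof \<pi> * Determinant.det (mat p p (\<lambda>(j, k). A j (\<pi> k)))"
    by (rule rows[of "\<lambda>j k. A j (\<pi> k)"])
  also have "Determinant.det (mat p p (\<lambda>(j, k). A j (\<pi> k))) = Determinant.det (mat p p (\<lambda>(j, k). A k (\<pi> j)))"
    by (rule transp[of "\<lambda>j k. A k (\<pi> j)"])
  also have "\<dots> = signof \<pi> * Determinant.det (mat p p (\<lambda>(j, k). A k j))"
    by (rule rows[of "\<lambda>j k. A k j"])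
  also have "Determinant.det (mat p p (\<lambda>(j, k). A k j)) = Determinant.det (mat p p (\<lambda>(j, k). A j k))"
    by (rule transp)
  finally show ?thesis
    by (simp add: mult.assoc[symmetric] of_int_mult[symmetric] del: of_int_mult)
qed

lemma kernel_tuple_det_permute:
  assumes "\<pi> permutes {0..<p}"
  shows "kernel_tuple_det t p (\<lambda>i\<in>{0..<p}. m (\<pi> i)) = kernel_tuple_det t p m"
proof -
  have "kernel_tuple_det t p (\<lambda>i\<in>{0..<p}. m (\<pi> i)) =
        Determinant.det (mat p p (\<lambda>(j, k). kernel t (m (\<pi> j)) (m (\<pi> k))))"
    unfolding kernel_tuple_det_def by (intro arg_cong[where f = Determinant.det] cong_mat) auto
  also have "\<dots> = kernel_tuple_det t p m"
    unfolding kernel_tuple_det_def by (rule det_permute_rows_cols[OF assms])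
  finally show ?thesis .
qed

lemma kernel_tuple_det_not_inj:
  assumes "\<not> inj_on m {0..<p}"
  shows "kernel_tuple_det t p m = 0"
proof -
  obtain i j where "i < p" "j < p" "i \<noteq> j" "m i = m j"
    using assms by (auto simp: inj_on_def)
  thus ?thesis
    unfolding kernel_tuple_det_def
    by (intro det_identical_rows[of _ p i j]) (auto intro!: eq_vecI)
qed

theorem proposition3p1:
  fixes n p :: nat and t :: real
  assumes "p \<ge> 1" and "0 < t" and "t < 1"
  shows "kernel_det t summable_on decreasing_tuples n p \<and>
         form_factor t n p = (- 1) ^ p * (\<Sum>\<^sub>\<infinity>ns\<in>decreasing_tuples n p. kernel_det t ns)"
proof
  let ?I = "{0..<p} \<rightarrow>\<^sub>E {n..}" and ?D = "decreasing_tuples n p"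
  let ?E = "kernel_tuple_det t p"
  note t = assms(2,3)
  have list: "?E ((!) ns) = kernel_det t ns" if "ns \<in> ?D" for ns
    using decreasing_tuples_distinct(2)[OF that] by (simp add: kernel_tuple_det_def kernel_det_def)
  have E: "?E = (\<lambda>m. (- t / pi\<^sup>2) ^ p * moment_det t p m)"
    using kernel_tuple_det_eq[OF t] by auto
  have sum_E: "?E summable_on ?I"
    unfolding E by (intro summable_on_cmult_right cube_integral_eq_moment_det_sum(1) t)
  have sym: "(\<lambda>ns. ?E ((!) ns)) summable_on ?D"
      "infsum ?E ?I = fact p * (\<Sum>\<^sub>\<infinity>ns\<in>?D. ?E ((!) ns))"
    by (rule infsum_symmetric_tuples[OF sum_E],
        erule kernel_tuple_det_permute, erule kernel_tuple_det_not_inj)+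
  show "kernel_det t summable_on ?D"
    using sym(1) by (rule summable_on_cong[THEN iffD1, rotated]) (rule list)
  have "infsum ?E ?I = fact p * (\<Sum>\<^sub>\<infinity>ns\<in>?D. kernel_det t ns)"
    unfolding sym(2) by (intro arg_cong2[where f = "(*)"] refl infsum_cong list)
  hence sum: "(- t / pi\<^sup>2) ^ p * infsum (moment_det t p) ?I = fact p * (\<Sum>\<^sub>\<infinity>ns\<in>?D. kernel_det t ns)"
    by (simp add: E infsum_cmult_right')
  have "form_factor t n p = (t ^ (p * (n + p))
     * (LINT x : PiE {1..2*p} (\<lambda>_. {0<..<1}) | PiM {1..2*p} (\<lambda>_. lborel). form_factor_integrand t n p x))
      / ((fact p)\<^sup>2 * pi ^ (2 * p))"
    by (simp add: form_factor_def)
  also have "\<dots> = t ^ p / pi ^ (2 * p) * infsum (moment_det t p) ?I / fact p"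
    unfolding cube_integral_eq_moment_det_sum(2)[OF t] by (simp add: power2_eq_square)
  also have "t ^ p / pi ^ (2 * p) = (- 1) ^ p * (- t / pi\<^sup>2) ^ p"
    by (simp add: power_mult_distrib[symmetric] power_divide power_mult)
  also have "(- 1) ^ p * (- t / pi\<^sup>2) ^ p * infsum (moment_det t p) ?I / fact p =
             (- 1) ^ p * (\<Sum>\<^sub>\<infinity>ns\<in>?D. kernel_det t ns)"
    unfolding mult.assoc sum by simp
  finally show "form_factor t n p = (- 1) ^ p * (\<Sum>\<^sub>\<infinity>ns\<in>?D. kernel_det t ns)" .
qed

end
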